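(* Let $C$ be an abelian category with $M$ the class of monomorphisms of $C$. Let $J$ be a class of diagram types. Then the full subcategory of $\tau_{J,M}$-compact objects forms an exact full abelian subcategory of $C$ (that is, it is abelian and its inclusion into $C$ is exact). In particular, the full subcategories of Artinian objects and of Noetherian objects of $C$ are abelian categories.
   Context: Variance. A variance on a category $I$ is a pair $(\mathrm{Cov},\mathrm{Contr})$ of classes of morphisms, each closed under composition and containing all identities, such that each morphism factors uniquely as $ba$ with $a\in \mathrm{Cov}$, $b\in\mathrm{Contr}$, and also uniquely as $ab$ with $a\in\mathrm{Cov}$, $b\in\mathrm{Contr}$. For $f\colon x\to y$ write $f=f^-f^+$ with $f^+\colon x\to f_t$ in $\mathrm{Cov}$, $f^-\colon f_t\to y$ in $\mathrm{Contr}$, and $f=f_+f_-$ with $f_-\colon x\to f_s$ in $\mathrm{Contr}$, $f_+\colon f_s\to y$ in $\mathrm{Cov}$. A functor $F\colon I\to D$ of variance $(\mathrm{Cov},\mathrm{Contr})$ assigns to each object $i$ an object $F(i)$ and to each morphism $f$ a morphism $F(f)\colon F(f_s)\to F(f_t)$, preserving identities, such that for each composable $x\xrightarrow{f}y\xrightarrow{g}z$, $$F(gf)=F((g^+f^-)^+)\circ F(f)\circ F((g_-f_+)_-)=F((g^+f^-)^-)\circ F(g)\circ F((g_-f_+)_+).$$ A diagram type is a tuple $(I,A,\mathrm{Cov},\mathrm{Contr})$ with $I$ a small category with variance $(\mathrm{Cov},\mathrm{Contr})$ and $A$ a nonempty set of objects of $I$ (the designated small objects) such that for all $x,y\in A$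 there are morphisms $x\to z\leftarrow y$ in $I$ with $z\in A$. For an object $c$, a $\tau_{J,M}$-covering of $c$ is a tuple $(F\colon I\to C/c,A,\mathrm{Cov},\mathrm{Contr})$ with $(I,A,\mathrm{Cov},\mathrm{Contr})\in J$ and $F$ a functor of variance $(\mathrm{Cov},\mathrm{Contr})$ into the slice category such that each $F(i)\colon c_i\to c$ is in $M$. The object $c$ is $\tau_{J,M}$-compact if for every such covering there is $i_0\in A$ such that $F(k)$ is an isomorphism for any composable pair $i_0\to i\xrightarrow{k}j$ in $I$. Noetherian (resp. Artinian) objects are the $\tau_{J,M}$-compact objects where $J$ consists of the single diagram type given by the poset $\mathbb N$ with all objects designated small and with the variance (all morphisms, identities), giving covariant functors (resp. the variance (identities, all morphisms), giving contravariant functors). *)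

theory Defs
  imports "HOL-Algebra.Group"
begin

section \<open>Categories\<close>

text \<open>Composition is written in applicative order: in \<open>g \<cdot> f\<close> the morphism \<open>f\<close> comes first.\<close>

record ('o, 'm) category =
  Obj :: "'o set"
  Mor :: "'m set"
  Dom :: "'m \<Rightarrow> 'o"
  Cod :: "'m \<Rightarrow> 'o"
  Ident :: "'o \<Rightarrow> 'm"
  Comp :: "'m \<Rightarrow> 'm \<Rightarrow> 'm"  (infixr "\<cdot>\<index>" 70)

definition Hom :: "('o, 'm, 'z) category_scheme \<Rightarrow> 'o \<Rightarrow> 'o \<Rightarrow> 'm set" where
  "Hom C x y = {f \<in> Mor C. Dom C f = x \<and> Cod C f = y}"

locale category =
  fixes C :: "('o, 'm, 'z) category_scheme" (structure)
  assumes Dom_in_Obj: "f \<in> Mor C \<Longrightarrow> Dom C f \<in> Obj C"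
    and Cod_in_Obj: "f \<in> Mor C \<Longrightarrow> Cod C f \<in> Obj C"
    and Ident_in_Hom: "x \<in> Obj C \<Longrightarrow> Ident C x \<in> Hom C x x"
    and Comp_in_Hom: "f \<in> Hom C x y \<Longrightarrow> g \<in> Hom C y z \<Longrightarrow> g \<cdot> f \<in> Hom C x z"
    and Comp_Ident_right: "f \<in> Mor C \<Longrightarrow> f \<cdot> Ident C (Dom C f) = f"
    and Comp_Ident_left: "f \<in> Mor C \<Longrightarrow> Ident C (Cod C f) \<cdot> f = f"
    and Comp_assoc:
      "f \<in> Hom C w x \<Longrightarrow> g \<in> Hom C x y \<Longrightarrow> h \<in> Hom C y z \<Longrightarrow> (h \<cdot> g) \<cdot> f = h \<cdot> (g \<cdot> f)"

definition monic :: "('o, 'm, 'z) category_scheme \<Rightarrow> 'm \<Rightarrow> bool" where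
  "monic C f \<longleftrightarrow> f \<in> Mor C \<and>
    (\<forall>x. \<forall>g \<in> Hom C x (Dom C f). \<forall>h \<in> Hom C x (Dom C f). f \<cdot>\<^bsub>C\<^esub> g = f \<cdot>\<^bsub>C\<^esub> h \<longrightarrow> g = h)"

definition epic :: "('o, 'm, 'z) category_scheme \<Rightarrow> 'm \<Rightarrow> bool" where
  "epic C f \<longleftrightarrow> f \<in> Mor C \<and>
    (\<forall>x. \<forall>g \<in> Hom C (Cod C f) x. \<forall>h \<in> Hom C (Cod C f) x. g \<cdot>\<^bsub>C\<^esub> f = h \<cdot>\<^bsub>C\<^esub> f \<longrightarrow> g = h)"

definition isomorphism :: "('o, 'm, 'z) category_scheme \<Rightarrow> 'm \<Rightarrow> bool" where
  "isomorphism C f \<longleftrightarrow> f \<in> Mor C \<and>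
    (\<exists>g \<in> Hom C (Cod C f) (Dom C f).
      g \<cdot>\<^bsub>C\<^esub> f = Ident C (Dom C f) \<and> f \<cdot>\<^bsub>C\<^esub> g = Ident C (Cod C f))"

definition zero_object :: "('o, 'm, 'z) category_scheme \<Rightarrow> 'o \<Rightarrow> bool" where
  "zero_object C z \<longleftrightarrow> z \<in> Obj C \<and>
    (\<forall>x \<in> Obj C. (\<exists>!f. f \<in> Hom C x z) \<and> (\<exists>!f. f \<in> Hom C z x))"

definition full_subcategory ::
    "('o, 'm, 'z) category_scheme \<Rightarrow> 'o set \<Rightarrow> ('o, 'm, 'z) category_scheme" where
  "full_subcategory C S =
    C\<lparr>Obj := S, Mor := {f \<in> Mor C. Dom C f \<in> S \<and> Cod C f \<in> S}\<rparr>"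

text \<open>A morphism of the slice from \<open>f\<close> to \<open>g\<close> is stored as the triple \<open>(f, u, g)\<close> with
  \<open>g \<cdot> u = f\<close>, because \<open>u\<close> alone does not determine \<open>f\<close> and \<open>g\<close>.\<close>

definition slice ::
    "('o, 'm, 'z) category_scheme \<Rightarrow> 'o \<Rightarrow> ('m, 'm \<times> 'm \<times> 'm) category" where
  "slice C c =
    \<lparr>Obj = {f \<in> Mor C. Cod C f = c},
     Mor = {(f, u, g). f \<in> Mor C \<and> Cod C f = c \<and> g \<in> Mor C \<and> Cod C g = c \<and>
              u \<in> Hom C (Dom C f) (Dom C g) \<and> g \<cdot>\<^bsub>C\<^esub> u = f},
     Dom = (\<lambda>(f, u, g). f),
     Cod = (\<lambda>(f, u, g). g),
     Ident = (\<lambda>f. (f, Ident C (Dom C f), f)),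
     Comp = (\<lambda>(g, v, h) (f, u, g'). (f, v \<cdot>\<^bsub>C\<^esub> u, h))\<rparr>"

locale cat_functor = source: category C + target: category D
  for C :: "('o, 'm, 'y) category_scheme" and D :: "('p, 'n, 'z) category_scheme" +
  fixes Fo :: "'o \<Rightarrow> 'p" and Fm :: "'m \<Rightarrow> 'n"
  assumes Fo_in_Obj: "x \<in> Obj C \<Longrightarrow> Fo x \<in> Obj D"
    and Fm_in_Hom: "f \<in> Hom C x y \<Longrightarrow> Fm f \<in> Hom D (Fo x) (Fo y)"
    and Fm_Ident: "x \<in> Obj C \<Longrightarrow> Fm (Ident C x) = Ident D (Fo x)"
    and Fm_Comp:
      "f \<in> Hom C x y \<Longrightarrow> g \<in> Hom C y z \<Longrightarrow> Fm (g \<cdot>\<^bsub>C\<^esub> f) = Fm g \<cdot>\<^bsub>D\<^esub> Fm f"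


section \<open>Abelian categories\<close>

record ('o, 'm) preadditive_category = "('o, 'm) category" +
  HomAdd :: "'m \<Rightarrow> 'm \<Rightarrow> 'm"  (infixl "\<oplus>\<index>" 65)
  HomZero :: "'o \<Rightarrow> 'o \<Rightarrow> 'm"

definition Hom_group ::
    "('o, 'm, 'z) preadditive_category_scheme \<Rightarrow> 'o \<Rightarrow> 'o \<Rightarrow> 'm monoid" where
  "Hom_group C x y = \<lparr>carrier = Hom C x y, mult = HomAdd C, one = HomZero C x y\<rparr>"

locale preadditive_category = category C
  for C :: "('o, 'm, 'z) preadditive_category_scheme" (structure) +
  assumes Hom_comm_group: "x \<in> Obj C \<Longrightarrow> y \<in> Obj C \<Longrightarrow> comm_group (Hom_group C x y)"
    and Comp_add_right:
      "f \<in> Hom C x y \<Longrightarrow> g \<in> Hom C x y \<Longrightarrow> h \<in> Hom C y z \<Longrightarrow> h \<cdot> (f \<oplus> g) = (h \<cdot> f) \<oplus> (h \<cdot> g)"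
    and Comp_add_left:
      "f \<in> Hom C y z \<Longrightarrow> g \<in> Hom C y z \<Longrightarrow> h \<in> Hom C x y \<Longrightarrow> (f \<oplus> g) \<cdot> h = (f \<cdot> h) \<oplus> (g \<cdot> h)"

definition is_kernel :: "('o, 'm, 'z) preadditive_category_scheme \<Rightarrow> 'm \<Rightarrow> 'm \<Rightarrow> bool" where
  "is_kernel C k f \<longleftrightarrow> f \<in> Mor C \<and> k \<in> Mor C \<and> Cod C k = Dom C f \<and>
    f \<cdot>\<^bsub>C\<^esub> k = HomZero C (Dom C k) (Cod C f) \<and>
    (\<forall>x. \<forall>h \<in> Hom C x (Dom C f). f \<cdot>\<^bsub>C\<^esub> h = HomZero C x (Cod C f) \<longrightarrow>
      (\<exists>!u. u \<in> Hom C x (Dom C k) \<and> k \<cdot>\<^bsub>C\<^esub> u = h))"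

definition is_cokernel :: "('o, 'm, 'z) preadditive_category_scheme \<Rightarrow> 'm \<Rightarrow> 'm \<Rightarrow> bool" where
  "is_cokernel C q f \<longleftrightarrow> f \<in> Mor C \<and> q \<in> Mor C \<and> Dom C q = Cod C f \<and>
    q \<cdot>\<^bsub>C\<^esub> f = HomZero C (Dom C f) (Cod C q) \<and>
    (\<forall>x. \<forall>h \<in> Hom C (Cod C f) x. h \<cdot>\<^bsub>C\<^esub> f = HomZero C (Dom C f) x \<longrightarrow>
      (\<exists>!u. u \<in> Hom C (Cod C q) x \<and> u \<cdot>\<^bsub>C\<^esub> q = h))"

definition is_biproduct ::
    "('o, 'm, 'z) preadditive_category_scheme \<Rightarrow> 'o \<Rightarrow> 'o \<Rightarrow> 'o \<Rightarrow> 'm \<Rightarrow> 'm \<Rightarrow> 'm \<Rightarrow> 'm \<Rightarrow> bool" where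
  "is_biproduct C x y b i\<^sub>1 i\<^sub>2 p\<^sub>1 p\<^sub>2 \<longleftrightarrow>
    b \<in> Obj C \<and> i\<^sub>1 \<in> Hom C x b \<and> i\<^sub>2 \<in> Hom C y b \<and> p\<^sub>1 \<in> Hom C b x \<and> p\<^sub>2 \<in> Hom C b y \<and>
    p\<^sub>1 \<cdot>\<^bsub>C\<^esub> i\<^sub>1 = Ident C x \<and> p\<^sub>2 \<cdot>\<^bsub>C\<^esub> i\<^sub>2 = Ident C y \<and>
    (i\<^sub>1 \<cdot>\<^bsub>C\<^esub> p\<^sub>1) \<oplus>\<^bsub>C\<^esub> (i\<^sub>2 \<cdot>\<^bsub>C\<^esub> p\<^sub>2) = Ident C b"

locale abelian_category = preadditive_category C
  for C :: "('o, 'm, 'z) preadditive_category_scheme" (structure) +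
  assumes ex_zero_object: "\<exists>z. zero_object C z"
    and ex_biproduct:
      "x \<in> Obj C \<Longrightarrow> y \<in> Obj C \<Longrightarrow> \<exists>b i\<^sub>1 i\<^sub>2 p\<^sub>1 p\<^sub>2. is_biproduct C x y b i\<^sub>1 i\<^sub>2 p\<^sub>1 p\<^sub>2"
    and ex_kernel: "f \<in> Mor C \<Longrightarrow> \<exists>k. is_kernel C k f"
    and ex_cokernel: "f \<in> Mor C \<Longrightarrow> \<exists>q. is_cokernel C q f"
    and monic_is_kernel: "monic C m \<Longrightarrow> \<exists>f. is_kernel C m f"
    and epic_is_cokernel: "epic C e \<Longrightarrow> \<exists>f. is_cokernel C e f"

text \<open>The sequence \<open>0 \<rightarrow> a \<rightarrow> b \<rightarrow> c \<rightarrow> 0\<close> with maps \<open>f\<close> and \<open>g\<close>.\<close>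

definition short_exact :: "('o, 'm, 'z) preadditive_category_scheme \<Rightarrow> 'm \<Rightarrow> 'm \<Rightarrow> bool" where
  "short_exact C f g \<longleftrightarrow> is_kernel C f g \<and> is_cokernel C g f"

locale exact_functor = cat_functor C D Fo Fm
  for C :: "('o, 'm, 'y) preadditive_category_scheme"
    and D :: "('p, 'n, 'z) preadditive_category_scheme"
    and Fo :: "'o \<Rightarrow> 'p" and Fm :: "'m \<Rightarrow> 'n" +
  assumes additive:
      "f \<in> Hom C x y \<Longrightarrow> g \<in> Hom C x y \<Longrightarrow> Fm (f \<oplus>\<^bsub>C\<^esub> g) = Fm f \<oplus>\<^bsub>D\<^esub> Fm g"
    and preserves_short_exact: "short_exact C f g \<Longrightarrow> short_exact D (Fm f) (Fm g)"

definition exact_full_abelian_subcategory ::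
    "('o, 'm, 'z) preadditive_category_scheme \<Rightarrow> 'o set \<Rightarrow> bool" where
  "exact_full_abelian_subcategory C S \<longleftrightarrow> S \<subseteq> Obj C \<and>
    abelian_category (full_subcategory C S) \<and>
    exact_functor (full_subcategory C S) C (\<lambda>x. x) (\<lambda>f. f)"


section \<open>Variances\<close>

definition cov_contr_factorization ::
    "('i, 'j, 'z) category_scheme \<Rightarrow> 'j set \<Rightarrow> 'j set \<Rightarrow> 'j \<Rightarrow> 'j \<times> 'j \<Rightarrow> bool" where
  "cov_contr_factorization I Cv Ct f = (\<lambda>(a, b).
    a \<in> Cv \<and> b \<in> Ct \<and> Cod I a = Dom I b \<and> f = b \<cdot>\<^bsub>I\<^esub> a)"

definition contr_cov_factorization ::
    "('i, 'j, 'z) category_scheme \<Rightarrow> 'j set \<Rightarrow> 'j set \<Rightarrow> 'j \<Rightarrow> 'j \<times> 'j \<Rightarrow> bool" where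
  "contr_cov_factorization I Cv Ct f = (\<lambda>(a, b).
    a \<in> Cv \<and> b \<in> Ct \<and> Cod I b = Dom I a \<and> f = a \<cdot>\<^bsub>I\<^esub> b)"

definition wide_subclass :: "('i, 'j, 'z) category_scheme \<Rightarrow> 'j set \<Rightarrow> bool" where
  "wide_subclass I S \<longleftrightarrow> S \<subseteq> Mor I \<and> (\<forall>x \<in> Obj I. Ident I x \<in> S) \<and>
    (\<forall>f \<in> S. \<forall>g \<in> S. Cod I f = Dom I g \<longrightarrow> g \<cdot>\<^bsub>I\<^esub> f \<in> S)"

locale variance = category I
  for I :: "('i, 'j, 'z) category_scheme" (structure) +
  fixes Cv Ct :: "'j set"
  assumes Cv_wide: "wide_subclass I Cv"
    and Ct_wide: "wide_subclass I Ct"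
    and ex1_cov_contr: "f \<in> Mor I \<Longrightarrow> \<exists>!p. cov_contr_factorization I Cv Ct f p"
    and ex1_contr_cov: "f \<in> Mor I \<Longrightarrow> \<exists>!p. contr_cov_factorization I Cv Ct f p"

text \<open>For \<open>f : x \<rightarrow> y\<close> these are \<open>f\<^sup>+ : x \<rightarrow> f\<^sub>t\<close>, \<open>f\<^sup>- : f\<^sub>t \<rightarrow> y\<close> with \<open>f = f\<^sup>- f\<^sup>+\<close>, and
  \<open>f\<^sub>- : x \<rightarrow> f\<^sub>s\<close>, \<open>f\<^sub>+ : f\<^sub>s \<rightarrow> y\<close> with \<open>f = f\<^sub>+ f\<^sub>-\<close>, in this order.\<close>

definition upper_cov :: "('i, 'j, 'z) category_scheme \<Rightarrow> 'j set \<Rightarrow> 'j set \<Rightarrow> 'j \<Rightarrow> 'j" where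
  "upper_cov I Cv Ct f = fst (THE p. cov_contr_factorization I Cv Ct f p)"

definition upper_contr :: "('i, 'j, 'z) category_scheme \<Rightarrow> 'j set \<Rightarrow> 'j set \<Rightarrow> 'j \<Rightarrow> 'j" where
  "upper_contr I Cv Ct f = snd (THE p. cov_contr_factorization I Cv Ct f p)"

definition lower_contr :: "('i, 'j, 'z) category_scheme \<Rightarrow> 'j set \<Rightarrow> 'j set \<Rightarrow> 'j \<Rightarrow> 'j" where
  "lower_contr I Cv Ct f = snd (THE p. contr_cov_factorization I Cv Ct f p)"

definition lower_cov :: "('i, 'j, 'z) category_scheme \<Rightarrow> 'j set \<Rightarrow> 'j set \<Rightarrow> 'j \<Rightarrow> 'j" where
  "lower_cov I Cv Ct f = fst (THE p. contr_cov_factorization I Cv Ct f p)"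

definition var_source :: "('i, 'j, 'z) category_scheme \<Rightarrow> 'j set \<Rightarrow> 'j set \<Rightarrow> 'j \<Rightarrow> 'i" where
  "var_source I Cv Ct f = Cod I (lower_contr I Cv Ct f)"

definition var_target :: "('i, 'j, 'z) category_scheme \<Rightarrow> 'j set \<Rightarrow> 'j set \<Rightarrow> 'j \<Rightarrow> 'i" where
  "var_target I Cv Ct f = Cod I (upper_cov I Cv Ct f)"

locale variance_functor = source: variance I Cv Ct + target: category D
  for I :: "('i, 'j, 'y) category_scheme" and Cv Ct :: "'j set"
    and D :: "('p, 'n, 'z) category_scheme" +
  fixes Fo :: "'i \<Rightarrow> 'p" and Fm :: "'j \<Rightarrow> 'n"
  assumes Fo_in_Obj: "i \<in> Obj I \<Longrightarrow> Fo i \<in> Obj D"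
    and Fm_in_Hom:
      "f \<in> Mor I \<Longrightarrow> Fm f \<in> Hom D (Fo (var_source I Cv Ct f)) (Fo (var_target I Cv Ct f))"
    and Fm_Ident: "i \<in> Obj I \<Longrightarrow> Fm (Ident I i) = Ident D (Fo i)"
    and Fm_Comp_first:
      "\<lbrakk>f \<in> Hom I x y; g \<in> Hom I y z;
        t = upper_cov I Cv Ct g \<cdot>\<^bsub>I\<^esub> upper_contr I Cv Ct f;
        s = lower_contr I Cv Ct g \<cdot>\<^bsub>I\<^esub> lower_cov I Cv Ct f\<rbrakk> \<Longrightarrow>
       Fm (g \<cdot>\<^bsub>I\<^esub> f) = Fm (upper_cov I Cv Ct t) \<cdot>\<^bsub>D\<^esub> Fm f \<cdot>\<^bsub>D\<^esub> Fm (lower_contr I Cv Ct s)"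
    and Fm_Comp_second:
      "\<lbrakk>f \<in> Hom I x y; g \<in> Hom I y z;
        t = upper_cov I Cv Ct g \<cdot>\<^bsub>I\<^esub> upper_contr I Cv Ct f;
        s = lower_contr I Cv Ct g \<cdot>\<^bsub>I\<^esub> lower_cov I Cv Ct f\<rbrakk> \<Longrightarrow>
       Fm (g \<cdot>\<^bsub>I\<^esub> f) = Fm (upper_contr I Cv Ct t) \<cdot>\<^bsub>D\<^esub> Fm g \<cdot>\<^bsub>D\<^esub> Fm (lower_cov I Cv Ct s)"


section \<open>Diagram types and compact objects\<close>

record ('i, 'j) diagram_type =
  Shape :: "('i, 'j) category"
  Small :: "'i set"
  Cov :: "'j set"
  Contr :: "'j set"

locale diagram_type = variance "Shape T" "Cov T" "Contr T"
  for T :: "('i, 'j) diagram_type" +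
  assumes Small_subset: "Small T \<subseteq> Obj (Shape T)"
    and Small_nonempty: "Small T \<noteq> {}"
    and Small_directed: "x \<in> Small T \<Longrightarrow> y \<in> Small T \<Longrightarrow>
      \<exists>z \<in> Small T. \<exists>f g. f \<in> Hom (Shape T) x z \<and> g \<in> Hom (Shape T) y z"

definition covering ::
    "('o, 'm, 'z) category_scheme \<Rightarrow> ('i, 'j) diagram_type set \<Rightarrow> 'm set \<Rightarrow> 'o \<Rightarrow>
     ('i, 'j) diagram_type \<Rightarrow> ('i \<Rightarrow> 'm) \<Rightarrow> ('j \<Rightarrow> 'm \<times> 'm \<times> 'm) \<Rightarrow> bool" where
  "covering C J M c T Fo Fm \<longleftrightarrow> T \<in> J \<and>
    variance_functor (Shape T) (Cov T) (Contr T) (slice C c) Fo Fm \<and>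
    (\<forall>i \<in> Obj (Shape T). Fo i \<in> M)"

definition compact_object ::
    "('o, 'm, 'z) category_scheme \<Rightarrow> ('i, 'j) diagram_type set \<Rightarrow> 'm set \<Rightarrow> 'o \<Rightarrow> bool" where
  "compact_object C J M c \<longleftrightarrow> c \<in> Obj C \<and>
    (\<forall>T Fo Fm. covering C J M c T Fo Fm \<longrightarrow>
      (\<exists>i\<^sub>0 \<in> Small T. \<forall>i j. \<forall>h \<in> Hom (Shape T) i\<^sub>0 i. \<forall>k \<in> Hom (Shape T) i j.
        isomorphism (slice C c) (Fm k)))"

definition monomorphisms :: "('o, 'm, 'z) category_scheme \<Rightarrow> 'm set" where
  "monomorphisms C = {m. monic C m}"

definition nat_poset :: "(nat, nat \<times> nat) category" where
  "nat_poset =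
    \<lparr>Obj = UNIV, Mor = {(m, n). m \<le> n}, Dom = fst, Cod = snd,
     Ident = (\<lambda>n. (n, n)), Comp = (\<lambda>g f. (fst f, snd g))\<rparr>"

definition ascending_type :: "(nat, nat \<times> nat) diagram_type" where
  "ascending_type =
    \<lparr>Shape = nat_poset, Small = UNIV,
     Cov = Mor nat_poset, Contr = range (Ident nat_poset)\<rparr>"

definition descending_type :: "(nat, nat \<times> nat) diagram_type" where
  "descending_type =
    \<lparr>Shape = nat_poset, Small = UNIV,
     Cov = range (Ident nat_poset), Contr = Mor nat_poset\<rparr>"

definition noetherian_object :: "('o, 'm, 'z) category_scheme \<Rightarrow> 'o \<Rightarrow> bool" where
  "noetherian_object C = compact_object C {ascending_type} (monomorphisms C)"

definition artinian_object :: "('o, 'm, 'z) category_scheme \<Rightarrow> 'o \<Rightarrow> bool" where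
  "artinian_object C = compact_object C {descending_type} (monomorphisms C)"

end

theory Submission
  imports Defs
begin

text \<open>A class of objects of an abelian category that contains the zero objects and is closed under
  subobjects, quotients and binary sums spans an exact abelian full subcategory; the statements about
  cokernels and epimorphisms follow from those about kernels and monomorphisms in the opposite
  category. A covering of \<open>c\<close> by monomorphisms is a diagram of subobjects of \<open>c\<close>. For \<open>p : c \<rightarrow> b\<close>
  and \<open>q : d \<rightarrow> b\<close> the monotone map \<open>m \<mapsto> q\<^sup>-\<^sup>1(p(m))\<close> turns it into a covering of \<open>d\<close>. For an
  epimorphism \<open>q\<close> and \<open>p = id\<close> this map reflects the order, so quotients of compact objects are
  compact. If \<open>i\<close> is a kernel of \<open>p\<close>, then nested subobjects of \<open>c\<close> with equal preimages under \<open>i\<close> and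
  equal images under \<open>p\<close> coincide; since the small objects are directed, \<open>c\<close> is compact as soon as
  the domain of \<open>i\<close> and the codomain of \<open>p\<close> are. Subobjects (\<open>p\<close> monic, \<open>i = 0\<close>) and binary sums
  are special cases.\<close>

section \<open>Categories and opposite categories\<close>

context category
begin

lemma Hom_Obj:
  assumes "f \<in> Hom C x y"
  shows "x \<in> Obj C" "y \<in> Obj C"
  using assms Dom_in_Obj Cod_in_Obj by (auto simp: Hom_def)

lemma Comp_Ident:
  assumes "f \<in> Hom C x y"
  shows "f \<cdot> Ident C x = f" "Ident C y \<cdot> f = f"
  using assms Comp_Ident_right Comp_Ident_left by (auto simp: Hom_def)

lemma monic_cancel:
  assumes "monic C m" "m \<in> Hom C y z" "g \<in> Hom C x y" "h \<in> Hom C x y" "m \<cdot> g = m \<cdot> h"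
  shows "g = h"
  using assms by (auto simp: monic_def Hom_def)

lemma monic_right_factor:
  assumes "monic C (g \<cdot> f)" "f \<in> Hom C x y" "g \<in> Hom C y z"
  shows "monic C f"
  unfolding monic_def
proof (intro conjI allI ballI impI)
  show "f \<in> Mor C" using assms by (simp add: Hom_def)
  fix w h k
  assume "h \<in> Hom C w (Dom C f)" "k \<in> Hom C w (Dom C f)" and eq: "f \<cdot> h = f \<cdot> k"
  then have h: "h \<in> Hom C w x" and k: "k \<in> Hom C w x"
    using assms by (auto simp: Hom_def)
  have "(g \<cdot> f) \<cdot> h = (g \<cdot> f) \<cdot> k"
    using Comp_assoc[OF h assms(2,3)] Comp_assoc[OF k assms(2,3)] eq by simp
  then show "h = k"
    using monic_cancel[OF assms(1) Comp_in_Hom[OF assms(2,3)] h k] by simp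
qed

lemma monic_Comp:
  assumes "monic C f" "monic C g" "f \<in> Hom C x y" "g \<in> Hom C y z"
  shows "monic C (g \<cdot> f)"
  unfolding monic_def
proof (intro conjI allI ballI impI)
  show "g \<cdot> f \<in> Mor C" using Comp_in_Hom[OF assms(3,4)] by (simp add: Hom_def)
  fix w h k
  assume "h \<in> Hom C w (Dom C (g \<cdot> f))" "k \<in> Hom C w (Dom C (g \<cdot> f))"
    and eq: "(g \<cdot> f) \<cdot> h = (g \<cdot> f) \<cdot> k"
  then have h: "h \<in> Hom C w x" and k: "k \<in> Hom C w x"
    using Comp_in_Hom[OF assms(3,4)] by (auto simp: Hom_def)
  have "g \<cdot> (f \<cdot> h) = g \<cdot> (f \<cdot> k)"
    using Comp_assoc[OF h assms(3,4)] Comp_assoc[OF k assms(3,4)] eq by simp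
  then have "f \<cdot> h = f \<cdot> k"
    by (rule monic_cancel[OF assms(2,4) Comp_in_Hom[OF h assms(3)] Comp_in_Hom[OF k assms(3)]])
  then show "h = k" by (rule monic_cancel[OF assms(1,3) h k])
qed

end

text \<open>\<open>Ident\<close> and \<open>HomAdd\<close> stay as they are, while
  \<open>HomZero\<close> exchanges its two objects just as the Hom sets do. Facts about cokernels
  and epimorphisms arise by instantiating facts about kernels and monomorphisms at this
  record.\<close>

definition opposite ::
    "('o, 'm, 'z) preadditive_category_scheme \<Rightarrow> ('o, 'm, 'z) preadditive_category_scheme" where
  "opposite C = C\<lparr>Dom := Cod C, Cod := Dom C, Comp := (\<lambda>g f. f \<cdot>\<^bsub>C\<^esub> g),
     HomZero := (\<lambda>x y. HomZero C y x)\<rparr>"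

text \<open>As simplification rules, these and the equivalences that follow turn an instance at
  \<open>opposite C\<close> into the dual statement in \<open>C\<close>.\<close>

lemma opposite_simps [simp]:
  "Obj (opposite C) = Obj C" "Mor (opposite C) = Mor C"
  "Dom (opposite C) = Cod C" "Cod (opposite C) = Dom C"
  "Ident (opposite C) = Ident C" "g \<cdot>\<^bsub>opposite C\<^esub> f = f \<cdot>\<^bsub>C\<^esub> g"
  "HomAdd (opposite C) = HomAdd C" "HomZero (opposite C) x y = HomZero C y x"
  "Hom (opposite C) x y = Hom C y x"
  by (auto simp: opposite_def Hom_def)

lemma monic_opposite [simp]: "monic (opposite C) f \<longleftrightarrow> epic C f"
  by (simp add: monic_def epic_def)

lemma epic_opposite [simp]: "epic (opposite C) f \<longleftrightarrow> monic C f"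
  by (simp add: monic_def epic_def)

lemma zero_object_opposite [simp]: "zero_object (opposite C) z \<longleftrightarrow> zero_object C z"
  by (auto simp: zero_object_def)

section \<open>Kernels and cokernels in preadditive and abelian categories\<close>

lemma is_kernel_opposite [simp]: "is_kernel (opposite C) k f \<longleftrightarrow> is_cokernel C k f"
  by (simp add: is_kernel_def is_cokernel_def)

lemma is_cokernel_opposite [simp]: "is_cokernel (opposite C) k f \<longleftrightarrow> is_kernel C k f"
  by (simp add: is_kernel_def is_cokernel_def)

context preadditive_category
begin

lemma HomZero_in_Hom:
  assumes "x \<in> Obj C" "y \<in> Obj C"
  shows "HomZero C x y \<in> Hom C x y"
proof -
  interpret H: comm_group "Hom_group C x y" by (rule Hom_comm_group[OF assms])
  show ?thesis using H.one_closed by (simp add: Hom_group_def)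
qed

lemma HomAdd_zero:
  assumes "f \<in> Hom C x y"
  shows "HomZero C x y \<oplus> f = f" "f \<oplus> HomZero C x y = f"
proof -
  interpret H: comm_group "Hom_group C x y" by (rule Hom_comm_group[OF Hom_Obj[OF assms]])
  show "HomZero C x y \<oplus> f = f" "f \<oplus> HomZero C x y = f"
    using H.l_one[of f] H.r_one[of f] assms by (simp_all add: Hom_group_def)
qed

lemma HomAdd_self_zero:
  assumes "f \<in> Hom C x y" "f \<oplus> g = f" "g \<in> Hom C x y"
  shows "g = HomZero C x y"
proof -
  interpret H: comm_group "Hom_group C x y" by (rule Hom_comm_group[OF Hom_Obj[OF assms(1)]])
  show ?thesis using H.l_cancel_one[of f g] assms by (simp add: Hom_group_def)
qed

text \<open>The difference is \<open>-f + g\<close>, formed with the inverse of the Hom group; it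
  reduces equality of \<open>f\<close> and \<open>g\<close> to the vanishing of
  \<open>d\<close>.\<close>

lemma ex_difference:
  assumes "f \<in> Hom C x y" "g \<in> Hom C x y"
  obtains d where "d \<in> Hom C x y" "g = f \<oplus> d"
proof -
  interpret H: comm_group "Hom_group C x y" by (rule Hom_comm_group[OF Hom_Obj[OF assms(1)]])
  let ?d = "inv\<^bsub>Hom_group C x y\<^esub> f \<otimes>\<^bsub>Hom_group C x y\<^esub> g"
  have f: "f \<in> carrier (Hom_group C x y)" and g: "g \<in> carrier (Hom_group C x y)"
    using assms by (simp_all add: Hom_group_def)
  have "?d \<in> carrier (Hom_group C x y)" using f g by simp
  moreover have "g = f \<otimes>\<^bsub>Hom_group C x y\<^esub> ?d"
    using f g by (simp add: H.m_assoc[symmetric])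
  ultimately show ?thesis using that[of ?d] by (simp add: Hom_group_def)
qed

text \<open>Bilinearity gives \<open>h 0 = h (0 + 0) = h 0 + h 0\<close>, and cancellation in the
  Hom group leaves zero.\<close>

lemma Comp_zero_right:
  assumes "h \<in> Hom C y z" "x \<in> Obj C"
  shows "h \<cdot> HomZero C x y = HomZero C x z"
proof -
  have 0: "HomZero C x y \<in> Hom C x y"
    using assms(2) Hom_Obj[OF assms(1)] by (simp add: HomZero_in_Hom)
  show ?thesis
    using Comp_in_Hom[OF 0 assms(1)] Comp_add_right[OF 0 0 assms(1)] HomAdd_zero[OF 0]
      HomAdd_self_zero by metis
qed

lemma Comp_zero_left:
  assumes "h \<in> Hom C x y" "z \<in> Obj C"
  shows "HomZero C y z \<cdot> h = HomZero C x z"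
proof -
  have 0: "HomZero C y z \<in> Hom C y z"
    using assms(2) Hom_Obj[OF assms(1)] by (simp add: HomZero_in_Hom)
  show ?thesis
    using Comp_in_Hom[OF assms(1) 0] Comp_add_left[OF 0 0 assms(1)] HomAdd_zero[OF 0]
      HomAdd_self_zero by metis
qed

text \<open>With \<open>h = g \<oplus> d\<close> the equation
  \<open>m \<cdot> g = m \<cdot> h\<close> becomes \<open>m \<cdot> d = 0\<close>, so a trivial
  kernel is enough.\<close>

lemma monicI:
  assumes m: "m \<in> Hom C y z"
    and zero: "\<And>x g. g \<in> Hom C x y \<Longrightarrow> m \<cdot> g = HomZero C x z \<Longrightarrow>
      g = HomZero C x y"
  shows "monic C m"
  unfolding monic_def
proof (intro conjI allI ballI impI)
  show "m \<in> Mor C" using m by (simp add: Hom_def)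
  fix x g h
  assume "g \<in> Hom C x (Dom C m)" "h \<in> Hom C x (Dom C m)" and eq: "m \<cdot> g = m \<cdot> h"
  then have g: "g \<in> Hom C x y" and h: "h \<in> Hom C x y"
    using m by (auto simp: Hom_def)
  obtain d where d: "d \<in> Hom C x y" "h = g \<oplus> d" by (rule ex_difference[OF g h])
  have "m \<cdot> g \<oplus> m \<cdot> d = m \<cdot> g"
    using Comp_add_right[OF g d(1) m] d(2) eq by simp
  then have "m \<cdot> d = HomZero C x z"
    using HomAdd_self_zero[OF Comp_in_Hom[OF g m] _ Comp_in_Hom[OF d(1) m]] by simp
  then have "d = HomZero C x y" using zero[OF d(1)] by simp
  then show "g = h" using d HomAdd_zero[OF g] by simp
qed

text \<open>Unique lifting is split into a monic \<open>k\<close> and mere existence of lifts, the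
  form in which kernels are used below. If \<open>k \<cdot> g = 0\<close>, then \<open>g\<close> and
  \<open>0\<close> both lift the zero morphism, so they agree.\<close>

lemma kernelE:
  assumes "is_kernel C k f" "f \<in> Hom C y z"
  obtains w where "k \<in> Hom C w y" "f \<cdot> k = HomZero C w z" "monic C k"
    "\<And>x h. h \<in> Hom C x y \<Longrightarrow> f \<cdot> h = HomZero C x z \<Longrightarrow>
      \<exists>u \<in> Hom C x w. k \<cdot> u = h"
proof -
  define w where "w = Dom C k"
  have k: "k \<in> Hom C w y" and fk: "f \<cdot> k = HomZero C w z"
    and ex1: "\<And>x h. h \<in> Hom C x y \<Longrightarrow> f \<cdot> h = HomZero C x z \<Longrightarrow>
      \<exists>!u. u \<in> Hom C x w \<and> k \<cdot> u = h"
    using assms unfolding is_kernel_def w_def by (simp_all add: Hom_def)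
  have "g = HomZero C x w" if g: "g \<in> Hom C x w" and kg: "k \<cdot> g = HomZero C x y" for x g
  proof -
    have x: "x \<in> Obj C" and y: "y \<in> Obj C" and w: "w \<in> Obj C"
      using Hom_Obj[OF g] Hom_Obj[OF k] by auto
    have "\<exists>!u. u \<in> Hom C x w \<and> k \<cdot> u = HomZero C x y"
      by (rule ex1[OF HomZero_in_Hom[OF x y] Comp_zero_right[OF assms(2) x]])
    then show ?thesis
      by (rule ex1E) (metis g kg Comp_zero_right[OF k x] HomZero_in_Hom[OF x w])
  qed
  then have "monic C k" by (rule monicI[OF k])
  moreover have "\<exists>u \<in> Hom C x w. k \<cdot> u = h" if "h \<in> Hom C x y" "f \<cdot> h =
    HomZero C x z" for x h
    using ex1[OF that] by blast
  ultimately show ?thesis by (rule that[OF k fk])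
qed

lemma kernelI:
  assumes f: "f \<in> Hom C y z" and k: "k \<in> Hom C w y" and fk: "f \<cdot> k = HomZero C w z"
    and mono: "monic C k"
    and factor: "\<And>x h. h \<in> Hom C x y \<Longrightarrow> f \<cdot> h = HomZero C x z \<Longrightarrow>
      \<exists>u \<in> Hom C x w. k \<cdot> u = h"
  shows "is_kernel C k f"
proof -
  have "\<exists>!u. u \<in> Hom C x w \<and> k \<cdot> u = h"
    if "h \<in> Hom C x y" "f \<cdot> h = HomZero C x z" for x h
    using factor[OF that] monic_cancel[OF mono k] by blast
  then show ?thesis
    using f k fk by (auto simp: is_kernel_def Hom_def)
qed

lemma preadditive_category_opposite: "preadditive_category (opposite C)"
proof -
  have "Hom_group (opposite C) x y = Hom_group C y x" for x y
    by (simp add: Hom_group_def)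
  moreover have "category (opposite C)"
  proof (rule category.intro)
    show "g \<cdot>\<^bsub>opposite C\<^esub> f \<in> Hom (opposite C) x z"
      if "f \<in> Hom (opposite C) x y" "g \<in> Hom (opposite C) y z" for f g x y z
      using that Comp_in_Hom[of g z y f x] by simp
    show "(h \<cdot>\<^bsub>opposite C\<^esub> g) \<cdot>\<^bsub>opposite C\<^esub> f =
      h \<cdot>\<^bsub>opposite C\<^esub> (g \<cdot>\<^bsub>opposite C\<^esub> f)"
      if "f \<in> Hom (opposite C) w x" "g \<in> Hom (opposite C) x y" "h \<in> Hom (opposite C) y z"
      for f g h w x y z
      using that Comp_assoc[of h z y g x f w] by simp
  qed (simp_all add: Dom_in_Obj Cod_in_Obj Ident_in_Hom Comp_Ident_right Comp_Ident_left)
  ultimately show ?thesis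
    by (auto intro!: preadditive_category.intro preadditive_category_axioms.intro
        simp: Hom_comm_group intro: Comp_add_right Comp_add_left)
qed

end

lemma is_biproduct_opposite [simp]:
  "is_biproduct (opposite C) x y b i\<^sub>1 i\<^sub>2 p\<^sub>1 p\<^sub>2 \<longleftrightarrow> is_biproduct C x y b p\<^sub>1 p\<^sub>2 i\<^sub>1 i\<^sub>2"
  by (auto simp: is_biproduct_def)

section \<open>Duality, normality of monomorphisms and epimorphisms, and image factorization\<close>

context abelian_category
begin

text \<open>The axioms come in dual pairs: kernels with cokernels, monic with epic. Zero objects are
  self-dual, and a biproduct stays one when injections and projections trade places.\<close>

lemma abelian_category_opposite: "abelian_category (opposite C)"
proof -
  interpret op: preadditive_category "opposite C" by (rule preadditive_category_opposite)
  show ?thesis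
  proof unfold_locales
    show "\<exists>b i\<^sub>1 i\<^sub>2 p\<^sub>1 p\<^sub>2. is_biproduct (opposite C) x y b i\<^sub>1 i\<^sub>2 p\<^sub>1 p\<^sub>2"
      if "x \<in> Obj (opposite C)" "y \<in> Obj (opposite C)" for x y
      using that ex_biproduct[of x y] by simp blast
  qed (simp_all add: ex_zero_object ex_kernel ex_cokernel monic_is_kernel epic_is_cokernel)
qed

lemma cokernelE:
  assumes "is_cokernel C q f" "f \<in> Hom C y z"
  obtains w where "q \<in> Hom C z w" "q \<cdot> f = HomZero C y w" "epic C q"
    "\<And>x h. h \<in> Hom C z x \<Longrightarrow> h \<cdot> f = HomZero C y x \<Longrightarrow>
      \<exists>u \<in> Hom C w x. u \<cdot> q = h"
proof -
  interpret op: abelian_category "opposite C" by (rule abelian_category_opposite)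
  show ?thesis using op.kernelE[of q f z y] that assms by auto
qed

text \<open>The axiom only says that \<open>m\<close> is a kernel of some \<open>f\<close>. Since
  \<open>f\<close> kills \<open>m\<close>, it factors through \<open>q\<close>; so whatever
  \<open>q\<close> kills is killed by \<open>f\<close> and lifts along \<open>m\<close>.\<close>

lemma monic_is_kernel_of_cokernel:
  assumes "monic C m" "is_cokernel C q m"
  shows "is_kernel C m q"
proof -
  define y z where "y = Dom C m" and "z = Cod C m"
  have m: "m \<in> Hom C y z" using assms by (simp add: monic_def Hom_def y_def z_def)
  obtain w where q: "q \<in> Hom C z w" "q \<cdot> m = HomZero C y w"
    and qf: "\<And>x h. h \<in> Hom C z x \<Longrightarrow> h \<cdot> m = HomZero C y x \<Longrightarrow>
      \<exists>u \<in> Hom C w x. u \<cdot> q = h"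
    by (rule cokernelE[OF assms(2) m]) blast
  obtain f v where f: "is_kernel C m f" "f \<in> Hom C z v"
    using monic_is_kernel[OF assms(1)] m by (auto simp: is_kernel_def Hom_def)
  obtain y' where "m \<in> Hom C y' z" and fm: "f \<cdot> m = HomZero C y' v"
    and mf: "\<And>x h. h \<in> Hom C x z \<Longrightarrow> f \<cdot> h = HomZero C x v \<Longrightarrow>
      \<exists>u \<in> Hom C x y'. m \<cdot> u = h"
    by (rule kernelE[OF f]) blast
  then have y': "y' = y" using m by (simp add: Hom_def)
  obtain u where u: "u \<in> Hom C w v" "u \<cdot> q = f" using qf[OF f(2)] fm y' by blast
  show ?thesis
  proof (rule kernelI[OF q(1) m q(2) assms(1)])
    fix x h assume h: "h \<in> Hom C x z" "q \<cdot> h = HomZero C x w"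
    have "f \<cdot> h = u \<cdot> (q \<cdot> h)" using Comp_assoc[OF h(1) q(1) u(1)] u(2) by simp
    also have "\<dots> = HomZero C x v"
      using Comp_zero_right[OF u(1)] Hom_Obj[OF h(1)] h(2) by simp
    finally show "\<exists>t \<in> Hom C x y. m \<cdot> t = h" using mf[OF h(1)] y' by simp
  qed
qed

lemma epic_is_cokernel_of_kernel:
  assumes "epic C e" "is_kernel C k e"
  shows "is_cokernel C e k"
proof -
  interpret op: abelian_category "opposite C" by (rule abelian_category_opposite)
  show ?thesis using op.monic_is_kernel_of_cokernel[of e k] assms by simp
qed

text \<open>For \<open>n \<cdot> e = f\<close>, if \<open>t \<cdot> e = 0\<close> then \<open>f\<close> factors through the subobject \<open>n \<cdot> ker t\<close>, which is the
  kernel of some \<open>z\<close>; since \<open>z\<close> kills \<open>f\<close> it kills the image \<open>n\<close>, so \<open>ker t\<close> splits.\<close>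

lemma image_factorization:
  assumes f: "f \<in> Hom C x y" and r: "is_cokernel C r f" and n: "is_kernel C n r"
  obtains w e where "n \<in> Hom C w y" "monic C n" "e \<in> Hom C x w" "epic C e" "n \<cdot> e = f"
proof -
  interpret op: abelian_category "opposite C" by (rule abelian_category_opposite)
  obtain v where r': "r \<in> Hom C y v" "r \<cdot> f = HomZero C x v"
    and r_factor: "\<And>s h. h \<in> Hom C y s \<Longrightarrow> h \<cdot> f = HomZero C x s \<Longrightarrow>
      \<exists>u \<in> Hom C v s. u \<cdot> r = h"
    by (rule cokernelE[OF r f]) blast
  obtain w where n': "n \<in> Hom C w y" "r \<cdot> n = HomZero C w v" "monic C n"
    and n_factor: "\<And>s h. h \<in> Hom C s y \<Longrightarrow> r \<cdot> h = HomZero C s v \<Longrightarrow>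
      \<exists>u \<in> Hom C s w. n \<cdot> u = h"
    by (rule kernelE[OF n r'(1)]) blast
  obtain e where e: "e \<in> Hom C x w" "n \<cdot> e = f"
    using n_factor[OF f r'(2)] by blast
  have "t = HomZero C w s" if t: "t \<in> Hom C w s" and te: "t \<cdot> e = HomZero C x s" for s t
  proof -
    obtain l where "is_kernel C l t" using ex_kernel t by (auto simp: Hom_def)
    then obtain a where l: "l \<in> Hom C a w" "t \<cdot> l = HomZero C a s" "monic C l"
      and l_factor: "\<And>q h. h \<in> Hom C q w \<Longrightarrow> t \<cdot> h = HomZero C q s \<Longrightarrow>
        \<exists>u \<in> Hom C q a. l \<cdot> u = h"
      by (rule kernelE[OF _ t]) blast
    obtain e' where e': "e' \<in> Hom C x a" "l \<cdot> e' = e"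
      using l_factor[OF e(1) te] by blast
    define m where "m = n \<cdot> l"
    have m: "m \<in> Hom C a y" "monic C m"
      using Comp_in_Hom[OF l(1) n'(1)] monic_Comp[OF l(3) n'(3) l(1) n'(1)]
      by (simp_all add: m_def)
    have fm: "f = m \<cdot> e'"
      using Comp_assoc[OF e'(1) l(1) n'(1)] e' e by (simp add: m_def)
    obtain z b where z: "is_kernel C m z" "z \<in> Hom C y b"
      using monic_is_kernel[OF m(2)] m(1) by (auto simp: is_kernel_def Hom_def)
    obtain a' where "m \<in> Hom C a' y" and zm: "z \<cdot> m = HomZero C a' b"
      and m_factor: "\<And>s h. h \<in> Hom C s y \<Longrightarrow> z \<cdot> h = HomZero C s b \<Longrightarrow>
        \<exists>u \<in> Hom C s a'. m \<cdot> u = h"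
      by (rule kernelE[OF z]) blast
    then have a': "a' = a" using m by (simp add: Hom_def)
    have objs: "x \<in> Obj C" "b \<in> Obj C" "a \<in> Obj C" "w \<in> Obj C"
      using Hom_Obj[OF f] Hom_Obj[OF z(2)] Hom_Obj[OF l(1)] by auto
    have "z \<cdot> f = HomZero C x b"
      using Comp_assoc[OF e'(1) m(1) z(2)] zm a' Comp_zero_left[OF e'(1) objs(2)]
      by (simp add: fm)
    then obtain z' where z': "z' \<in> Hom C v b" "z' \<cdot> r = z"
      using r_factor[OF z(2)] by blast
    have "z \<cdot> n = HomZero C w b"
      using Comp_assoc[OF n'(1) r'(1) z'(1)] z'(2) n'(2) Comp_zero_right[OF z'(1) objs(4)] by simp
    then obtain u where u: "u \<in> Hom C w a" "m \<cdot> u = n"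
      using m_factor[OF n'(1)] a' by blast
    have "n \<cdot> (l \<cdot> u) = n \<cdot> Ident C w"
      using Comp_assoc[OF u(1) l(1) n'(1)] u(2) Comp_Ident[OF n'(1)] by (simp add: m_def)
    then have "l \<cdot> u = Ident C w"
      by (rule monic_cancel[OF n'(3,1) Comp_in_Hom[OF u(1) l(1)] Ident_in_Hom[OF objs(4)]])
    then have "t = (t \<cdot> l) \<cdot> u"
      using Comp_assoc[OF u(1) l(1) t] Comp_Ident[OF t] by simp
    also have "\<dots> = HomZero C w s"
      using l(2) Comp_zero_left[OF u(1)] Hom_Obj[OF t] by simp
    finally show ?thesis .
  qed
  then have "epic C e" using op.monicI[of e w x] e(1) by simp
  then show ?thesis using that n' e by blast
qed

end

section \<open>Full subcategories closed under subobjects, quotients and sums\<close>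

lemma full_subcategory_simps [simp]:
  "Obj (full_subcategory C S) = S"
  "Mor (full_subcategory C S) = {f \<in> Mor C. Dom C f \<in> S \<and> Cod C f \<in> S}"
  "Dom (full_subcategory C S) = Dom C" "Cod (full_subcategory C S) = Cod C"
  "Ident (full_subcategory C S) = Ident C" "Comp (full_subcategory C S) = Comp C"
  by (simp_all add: full_subcategory_def)

lemma full_subcategory_preadditive_simps [simp]:
  "HomAdd (full_subcategory C S) = HomAdd C" "HomZero (full_subcategory C S) = HomZero C"
  by (simp_all add: full_subcategory_def)

lemma Hom_full_subcategory: "Hom (full_subcategory C S) x y = (if x \<in> S \<and>
  y \<in> S then Hom C x y else {})"
  by (auto simp: Hom_def)

text \<open>Allows the dual half of the statements about a full subcategory to be read off from the
  opposite category.\<close>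

lemma full_subcategory_opposite: "full_subcategory (opposite C) S = opposite (full_subcategory C S)"
  by (cases C) (auto simp: full_subcategory_def opposite_def)

lemma (in category) category_full_subcategory:
  assumes "S \<subseteq> Obj C"
  shows "category (full_subcategory C S)"
proof (rule category.intro)
  show "g \<cdot>\<^bsub>full_subcategory C S\<^esub> f \<in> Hom (full_subcategory C S) x z"
    if "f \<in> Hom (full_subcategory C S) x y" "g \<in> Hom (full_subcategory C S) y z" for f g x y z
    using that Comp_in_Hom[of f x y g z] by (simp add: Hom_full_subcategory split: if_splits)
  show "(h \<cdot>\<^bsub>full_subcategory C S\<^esub> g) \<cdot>\<^bsub>full_subcategory C S\<^esub> f =
      h \<cdot>\<^bsub>full_subcategory C S\<^esub> (g \<cdot>\<^bsub>full_subcategory C S\<^esub> f)"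
    if "f \<in> Hom (full_subcategory C S) w x" "g \<in> Hom (full_subcategory C S) x y"
      "h \<in> Hom (full_subcategory C S) y z" for f g h w x y z
    using that Comp_assoc[of f w x g y h z] by (simp add: Hom_full_subcategory split: if_splits)
qed (use assms in \<open>auto simp: Hom_full_subcategory Ident_in_Hom Comp_Ident_right Comp_Ident_left\<close>)

lemma (in preadditive_category) preadditive_category_full_subcategory:
  assumes "S \<subseteq> Obj C"
  shows "preadditive_category (full_subcategory C S)"
proof -
  have "Hom_group (full_subcategory C S) x y = Hom_group C x y" if "x \<in> S" "y \<in> S" for x y
    using that by (simp add: Hom_group_def Hom_full_subcategory)
  then show ?thesis
    using category_full_subcategory[OF assms] assms
    by (auto intro!: preadditive_category.intro preadditive_category_axioms.intro Hom_comm_group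
        intro: Comp_add_right Comp_add_left simp: Hom_full_subcategory split: if_splits)
qed

text \<open>The closure conditions are self-dual as a whole, since passing to the opposite category
  exchanges subobjects with quotients. Hence only the kernel half of each argument has to be carried
  out.\<close>

locale abelian_closed_class = abelian_category C
  for C :: "('o, 'm, 'z) preadditive_category_scheme" (structure) +
  fixes S :: "'o set"
  assumes S_subset: "S \<subseteq> Obj C"
    and zero_closed: "zero_object C z \<Longrightarrow> z \<in> S"
    and biproduct_closed: "x \<in> S \<Longrightarrow> y \<in> S \<Longrightarrow>
      is_biproduct C x y b i\<^sub>1 i\<^sub>2 p\<^sub>1 p\<^sub>2 \<Longrightarrow> b \<in> S"
    and subobject_closed: "monic C m \<Longrightarrow> Cod C m \<in> S \<Longrightarrow> Dom C m \<in> S"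
    and quotient_closed: "epic C e \<Longrightarrow> Dom C e \<in> S \<Longrightarrow> Cod C e \<in> S"
begin

abbreviation "D \<equiv> full_subcategory C S"

lemma abelian_closed_class_opposite: "abelian_closed_class (opposite C) S"
proof -
  interpret op: abelian_category "opposite C" by (rule abelian_category_opposite)
  show ?thesis
    by unfold_locales
      (simp_all add: S_subset zero_closed subobject_closed quotient_closed, rule biproduct_closed)
qed

text \<open>A kernel is monic into an object of \<open>S\<close>, so its domain is in
  \<open>S\<close>; the universal property is then merely restricted to fewer test objects.\<close>

lemma kernel_in_full_subcategory:
  assumes "is_kernel C k f" "f \<in> Mor D"
  shows "is_kernel D k f"
proof -
  have f: "f \<in> Hom C (Dom C f) (Cod C f)" using assms(2) by (simp add: Hom_def)
  have "monic C k" by (rule kernelE[OF assms(1) f]) blast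
  then have "Dom C k \<in> S"
    using assms subobject_closed by (simp add: is_kernel_def)
  then show ?thesis
    using assms by (auto simp: is_kernel_def Hom_full_subcategory)
qed

text \<open>The kernel \<open>k\<close> of \<open>m\<close> in \<open>C\<close> has its domain in
  \<open>S\<close>, so it is a test morphism inside \<open>D\<close>. There
  \<open>m \<cdot> k = m \<cdot> 0\<close> forces \<open>k = 0\<close>, and a trivial kernel makes
  \<open>m\<close> monic in \<open>C\<close>.\<close>

lemma monic_in_full_subcategory:
  assumes "monic D m"
  shows "monic C m"
proof -
  define y z where "y = Dom C m" and "z = Cod C m"
  have m: "m \<in> Hom C y z" "y \<in> S" "z \<in> S"
    using assms by (auto simp: monic_def Hom_def y_def z_def)
  obtain k where k: "is_kernel C k m" using ex_kernel m by (auto simp: Hom_def)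
  obtain w where kw: "k \<in> Hom C w y" "m \<cdot> k = HomZero C w z" "monic C k"
    and factor: "\<And>x h. h \<in> Hom C x y \<Longrightarrow> m \<cdot> h = HomZero C x z \<Longrightarrow>
      \<exists>u \<in> Hom C x w. k \<cdot> u = h"
    by (rule kernelE[OF k m(1)]) blast
  have w: "w \<in> S" using subobject_closed[OF kw(3)] kw(1) m by (auto simp: Hom_def)
  then have wy: "w \<in> Obj C" "y \<in> Obj C" using m S_subset by auto
  have "k = HomZero C w y"
  proof (rule category.monic_cancel[OF category_full_subcategory[OF S_subset] assms, of y z _ w])
    show "m \<cdot>\<^bsub>D\<^esub> k = m \<cdot>\<^bsub>D\<^esub> HomZero C w y"
      using kw(2) Comp_zero_right[OF m(1) wy(1)] by simp
  qed (use m w kw HomZero_in_Hom[OF wy] in \<open>simp_all add: Hom_full_subcategory\<close>)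
  then show ?thesis
    using factor Comp_zero_left[OF _ wy(2)] by (intro monicI[OF m(1)]) metis
qed

text \<open>A kernel \<open>l\<close> of \<open>f\<close> formed in \<open>C\<close> lies in
  \<open>D\<close>, so it lifts along \<open>k\<close>. Any morphism of \<open>C\<close> killed by
  \<open>f\<close> then lifts along \<open>l\<close> and hence along \<open>k\<close>. This yields
  exactness of the inclusion.\<close>

lemma kernel_of_full_subcategory:
  assumes "is_kernel D k f"
  shows "is_kernel C k f"
proof -
  interpret D: preadditive_category D
    by (rule preadditive_category_full_subcategory[OF S_subset])
  define y z where "y = Dom C f" and "z = Cod C f"
  have f: "f \<in> Hom D y z" "f \<in> Hom C y z"
    using assms by (auto simp: is_kernel_def Hom_def y_def z_def)
  obtain w where k: "k \<in> Hom D w y" "f \<cdot> k = HomZero C w z" "monic D k"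
    and factor: "\<And>x h. h \<in> Hom D x y \<Longrightarrow> f \<cdot> h = HomZero C x z \<Longrightarrow>
      \<exists>u \<in> Hom D x w. k \<cdot> u = h"
    by (rule D.kernelE[OF assms f(1), simplified]) blast
  have kC: "k \<in> Hom C w y" "w \<in> S" using k(1) by (simp_all add: Hom_full_subcategory split: if_splits)
  obtain l where l: "is_kernel C l f" using ex_kernel f by (auto simp: Hom_def)
  then have l_D: "is_kernel D l f" using kernel_in_full_subcategory[OF l] f by (auto simp: Hom_def)
  define v where "v = Dom C l"
  have lv: "l \<in> Hom D v y" "f \<cdot> l = HomZero C v z"
    using l_D f(1) unfolding is_kernel_def v_def by (simp_all add: Hom_def)
  obtain v' where "l \<in> Hom C v' y"
    and l_factor: "\<And>x h. h \<in> Hom C x y \<Longrightarrow> f \<cdot> h = HomZero C x z \<Longrightarrow>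
      \<exists>u \<in> Hom C x v'. l \<cdot> u = h"
    by (rule kernelE[OF l f(2)]) blast
  then have v': "v' = v" using lv(1) by (simp add: Hom_def)
  obtain u where u: "u \<in> Hom D v w" "k \<cdot> u = l" using factor[OF lv] by blast
  then have uC: "u \<in> Hom C v w" by (simp add: Hom_full_subcategory split: if_splits)
  show ?thesis
  proof (rule kernelI[OF f(2) kC(1) k(2) monic_in_full_subcategory[OF k(3)]])
    fix x h assume h: "h \<in> Hom C x y" "f \<cdot> h = HomZero C x z"
    then obtain t where t: "t \<in> Hom C x v" "l \<cdot> t = h" using l_factor v' by blast
    then show "\<exists>s \<in> Hom C x w. k \<cdot> s = h"
      using Comp_in_Hom[OF t(1) uC] Comp_assoc[OF t(1) uC kC(1)] u(2) by force
  qed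
qed

text \<open>The cokernel of \<open>m\<close> in \<open>C\<close> stays in \<open>D\<close> by
  closure under quotients, and \<open>m\<close> is its kernel in \<open>C\<close>, hence also in
  \<open>D\<close>.\<close>

lemma monic_is_kernel_full_subcategory:
  assumes "monic D m"
  shows "\<exists>f. is_kernel D m f"
proof -
  have m: "monic C m" "m \<in> Hom C (Dom C m) (Cod C m)" "Cod C m \<in> S"
    using assms monic_in_full_subcategory by (auto simp: monic_def Hom_def)
  obtain q where q: "is_cokernel C q m" using ex_cokernel m by (auto simp: Hom_def)
  have "epic C q" by (rule cokernelE[OF q m(2)]) blast
  then have "q \<in> Mor D" using q m(3) quotient_closed by (auto simp: is_cokernel_def)
  then show ?thesis
    using kernel_in_full_subcategory monic_is_kernel_of_cokernel[OF m(1) q] by blast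
qed

lemma abelian_full_subcategory: "abelian_category D"
proof -
  interpret op: abelian_closed_class "opposite C" S by (rule abelian_closed_class_opposite)
  show ?thesis
  proof (intro abelian_category.intro abelian_category_axioms.intro)
    show "preadditive_category D" by (rule preadditive_category_full_subcategory[OF S_subset])
    show "\<exists>z. zero_object D z"
    proof -
      obtain z where z: "zero_object C z" using ex_zero_object by blast
      have zS: "z \<in> S" by (rule zero_closed[OF z])
      have "(\<exists>!f. f \<in> Hom D x z) \<and> (\<exists>!f. f \<in> Hom D z x)" if x: "x \<in> S" for x
        using z x zS S_subset by (simp add: Hom_full_subcategory zero_object_def subset_iff)
      then have "zero_object D z" using zS by (simp add: zero_object_def)
      then show ?thesis ..
    qed
    show "\<exists>b i\<^sub>1 i\<^sub>2 p\<^sub>1 p\<^sub>2. is_biproduct D x y b i\<^sub>1 i\<^sub>2 p\<^sub>1 p\<^sub>2"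
      if xy: "x \<in> Obj D" "y \<in> Obj D" for x y
    proof -
      have "x \<in> Obj C" "y \<in> Obj C" using xy S_subset by auto
      from ex_biproduct[OF this] obtain b i\<^sub>1 i\<^sub>2 p\<^sub>1 p\<^sub>2
        where b: "is_biproduct C x y b i\<^sub>1 i\<^sub>2 p\<^sub>1 p\<^sub>2"
        by blast
      then have "is_biproduct D x y b i\<^sub>1 i\<^sub>2 p\<^sub>1 p\<^sub>2"
        using biproduct_closed[OF _ _ b] xy by (simp add: is_biproduct_def Hom_full_subcategory)
      then show ?thesis by blast
    qed
    show "\<exists>k. is_kernel D k f" if f: "f \<in> Mor D" for f
      using ex_kernel[of f] kernel_in_full_subcategory[OF _ f] f by auto
    show "\<exists>q. is_cokernel D q f" if f: "f \<in> Mor D" for f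
      using ex_cokernel[of f] op.kernel_in_full_subcategory[of _ f] f
      by (auto simp: full_subcategory_opposite)
    show "\<exists>f. is_kernel D m f" if "monic D m" for m
      by (rule monic_is_kernel_full_subcategory[OF that])
    show "\<exists>f. is_cokernel D e f" if "epic D e" for e
      using op.monic_is_kernel_full_subcategory[of e] that by (simp add: full_subcategory_opposite)
  qed
qed

text \<open>A short exact sequence is a kernel paired with a cokernel. Kernels of \<open>D\<close>
  are kernels of \<open>C\<close>, and the opposite category supplies the same for
  cokernels.\<close>

lemma exact_full_subcategory: "exact_full_abelian_subcategory C S"
proof -
  interpret op: abelian_closed_class "opposite C" S by (rule abelian_closed_class_opposite)
  interpret D: abelian_category D by (rule abelian_full_subcategory)
  have "exact_functor D C (\<lambda>x. x) (\<lambda>f. f)"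
  proof unfold_locales
    show "short_exact C f g" if "short_exact D f g" for f g
      using that kernel_of_full_subcategory[of f g] op.kernel_of_full_subcategory[of g f]
      by (simp add: short_exact_def full_subcategory_opposite)
  qed (use S_subset in \<open>auto simp: Hom_full_subcategory split: if_splits\<close>)
  then show ?thesis
    using S_subset abelian_full_subcategory by (simp add: exact_full_abelian_subcategory_def)
qed

end

section \<open>Functors of variance\<close>

context variance
begin

lemma Cv_in_Mor: "a \<in> Cv \<Longrightarrow> a \<in> Mor I"
  using Cv_wide by (auto simp: wide_subclass_def)

lemma Ct_in_Mor: "b \<in> Ct \<Longrightarrow> b \<in> Mor I"
  using Ct_wide by (auto simp: wide_subclass_def)

lemma Ident_in_Cv: "x \<in> Obj I \<Longrightarrow> Ident I x \<in> Cv"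
  using Cv_wide by (auto simp: wide_subclass_def)

lemma Ident_in_Ct: "x \<in> Obj I \<Longrightarrow> Ident I x \<in> Ct"
  using Ct_wide by (auto simp: wide_subclass_def)

lemma Dom_Cod_Ident: "x \<in> Obj I \<Longrightarrow> Dom I (Ident I x) = x" "x \<in> Obj I \<Longrightarrow>
  Cod I (Ident I x) = x"
  using Ident_in_Hom by (auto simp: Hom_def)

lemma upper_factorization:
  assumes "f \<in> Hom I x y"
  shows "upper_cov I Cv Ct f \<in> Cv" "upper_contr I Cv Ct f \<in> Ct"
    "upper_cov I Cv Ct f \<in> Hom I x (var_target I Cv Ct f)"
    "upper_contr I Cv Ct f \<in> Hom I (var_target I Cv Ct f) y"
proof -
  let ?a = "upper_cov I Cv Ct f" and ?b = "upper_contr I Cv Ct f"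
  have "f \<in> Mor I" using assms by (simp add: Hom_def)
  from theI'[OF ex1_cov_contr[OF this]]
  have *: "?a \<in> Cv" "?b \<in> Ct" "Cod I ?a = Dom I ?b" "f = ?b \<cdot> ?a"
    by (simp_all add: cov_contr_factorization_def upper_cov_def upper_contr_def case_prod_beta)
  have "?a \<in> Hom I (Dom I ?a) (Dom I ?b)" "?b \<in> Hom I (Dom I ?b) (Cod I ?b)"
    using *(1-3) Cv_in_Mor Ct_in_Mor by (auto simp: Hom_def)
  then have "f \<in> Hom I (Dom I ?a) (Cod I ?b)" using Comp_in_Hom *(4) by metis
  then show "?a \<in> Cv" "?b \<in> Ct" "?a \<in> Hom I x (var_target I Cv Ct f)"
    "?b \<in> Hom I (var_target I Cv Ct f) y"
    using * assms Cv_in_Mor Ct_in_Mor by (auto simp: Hom_def var_target_def)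
qed

lemma lower_factorization:
  assumes "f \<in> Hom I x y"
  shows "lower_cov I Cv Ct f \<in> Cv" "lower_contr I Cv Ct f \<in> Ct"
    "lower_contr I Cv Ct f \<in> Hom I x (var_source I Cv Ct f)"
    "lower_cov I Cv Ct f \<in> Hom I (var_source I Cv Ct f) y"
proof -
  let ?a = "lower_cov I Cv Ct f" and ?b = "lower_contr I Cv Ct f"
  have "f \<in> Mor I" using assms by (simp add: Hom_def)
  from theI'[OF ex1_contr_cov[OF this]]
  have *: "?a \<in> Cv" "?b \<in> Ct" "Cod I ?b = Dom I ?a" "f = ?a \<cdot> ?b"
    by (simp_all add: contr_cov_factorization_def lower_cov_def lower_contr_def case_prod_beta)
  have "?b \<in> Hom I (Dom I ?b) (Dom I ?a)" "?a \<in> Hom I (Dom I ?a) (Cod I ?a)"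
    using *(1-3) Cv_in_Mor Ct_in_Mor by (auto simp: Hom_def)
  then have "f \<in> Hom I (Dom I ?b) (Cod I ?a)" using Comp_in_Hom *(4) by metis
  then show "?a \<in> Cv" "?b \<in> Ct" "?b \<in> Hom I x (var_source I Cv Ct f)"
    "?a \<in> Hom I (var_source I Cv Ct f) y"
    using * assms Cv_in_Mor Ct_in_Mor by (auto simp: Hom_def var_source_def)
qed

text \<open>Both factorizations of a covariant morphism pair it with an identity, by uniqueness. So
  a functor of variance treats \<open>Cv\<close> covariantly and, by the companion lemma,
  \<open>Ct\<close> contravariantly.\<close>

lemma var_source_target_Cv:
  assumes "a \<in> Cv"
  shows "var_source I Cv Ct a = Dom I a" "var_target I Cv Ct a = Cod I a"
proof -
  have a: "a \<in> Mor I" using assms by (rule Cv_in_Mor)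
  have x: "Dom I a \<in> Obj I" and y: "Cod I a \<in> Obj I" using a Dom_in_Obj Cod_in_Obj by auto
  have "(THE p. cov_contr_factorization I Cv Ct a p) = (a, Ident I (Cod I a))"
    using assms a y by (intro the1_equality ex1_cov_contr)
      (auto simp: cov_contr_factorization_def Ident_in_Ct Dom_Cod_Ident Comp_Ident_left)
  then show "var_target I Cv Ct a = Cod I a" by (simp add: var_target_def upper_cov_def)
  have "(THE p. contr_cov_factorization I Cv Ct a p) = (a, Ident I (Dom I a))"
    using assms a x by (intro the1_equality ex1_contr_cov)
      (auto simp: contr_cov_factorization_def Ident_in_Ct Dom_Cod_Ident Comp_Ident_right)
  then show "var_source I Cv Ct a = Dom I a"
    using x by (simp add: var_source_def lower_contr_def Dom_Cod_Ident)
qed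

lemma var_source_target_Ct:
  assumes "b \<in> Ct"
  shows "var_source I Cv Ct b = Cod I b" "var_target I Cv Ct b = Dom I b"
proof -
  have b: "b \<in> Mor I" using assms by (rule Ct_in_Mor)
  have x: "Dom I b \<in> Obj I" and y: "Cod I b \<in> Obj I" using b Dom_in_Obj Cod_in_Obj by auto
  have "(THE p. cov_contr_factorization I Cv Ct b p) = (Ident I (Dom I b), b)"
    using assms b x by (intro the1_equality ex1_cov_contr)
      (auto simp: cov_contr_factorization_def Ident_in_Cv Dom_Cod_Ident Comp_Ident_right)
  then show "var_target I Cv Ct b = Dom I b"
    using x by (simp add: var_target_def upper_cov_def Dom_Cod_Ident)
  have "(THE p. contr_cov_factorization I Cv Ct b p) = (Ident I (Cod I b), b)"
    using assms b y by (intro the1_equality ex1_contr_cov)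
      (auto simp: contr_cov_factorization_def Ident_in_Cv Dom_Cod_Ident Comp_Ident_left)
  then show "var_source I Cv Ct b = Cod I b" by (simp add: var_source_def lower_contr_def)
qed

end

text \<open>In both composition laws the outer two factors come from \<open>Cv\<close> or
  \<open>Ct\<close>, where the direction of \<open>Fm\<close> is known. The triple is thus
  composable in \<open>D\<close>, and \<open>Gm\<close> distributes over it.\<close>

lemma variance_functor_comp:
  assumes F: "variance_functor I Cv Ct D Fo Fm" and G: "cat_functor D E Go Gm"
  shows "variance_functor I Cv Ct E (\<lambda>i. Go (Fo i)) (\<lambda>f. Gm (Fm f))"
proof -
  interpret F: variance_functor I Cv Ct D Fo Fm by (rule F)
  interpret G: cat_functor D E Go Gm by (rule G)
  have Gm3: "Gm (h \<cdot>\<^bsub>D\<^esub> g \<cdot>\<^bsub>D\<^esub> f) =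
    Gm h \<cdot>\<^bsub>E\<^esub> Gm g \<cdot>\<^bsub>E\<^esub> Gm f"
    if "f \<in> Hom D w x" "g \<in> Hom D x y" "h \<in> Hom D y z" for f g h w x y z
    using G.Fm_Comp[OF F.target.Comp_in_Hom[OF that(1,2)] that(3)] G.Fm_Comp[OF that(1,2)] by simp
  have cov: "Fm a \<in> Hom D (Fo x) (Fo y)" if "a \<in> Cv" "a \<in> Hom I x y" for a x y
    using F.Fm_in_Hom[of a] F.source.var_source_target_Cv[OF that(1)] that(2) by (auto simp: Hom_def)
  have contr: "Fm b \<in> Hom D (Fo y) (Fo x)" if "b \<in> Ct" "b \<in> Hom I x y" for b x y
    using F.Fm_in_Hom[of b] F.source.var_source_target_Ct[OF that(1)] that(2) by (auto simp: Hom_def)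
  have middle: "Fm f \<in> Hom D (Fo (var_source I Cv Ct f)) (Fo (var_target I Cv Ct f))"
    if "f \<in> Hom I x y" for f x y
    using F.Fm_in_Hom[of f] that by (simp add: Hom_def)
  show ?thesis
  proof unfold_locales
    show "Go (Fo i) \<in> Obj E" if "i \<in> Obj I" for i
      using that F.Fo_in_Obj G.Fo_in_Obj by blast
    show "Gm (Fm f) \<in> Hom E (Go (Fo (var_source I Cv Ct f))) (Go (Fo (var_target I Cv Ct f)))"
      if "f \<in> Mor I" for f
      using that F.Fm_in_Hom G.Fm_in_Hom by blast
    show "Gm (Fm (Ident I i)) = Ident E (Go (Fo i))" if "i \<in> Obj I" for i
      using that F.Fm_Ident G.Fm_Ident F.Fo_in_Obj by simp
    fix f g x y z t s
    assume f: "f \<in> Hom I x y" and g: "g \<in> Hom I y z"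
      and t: "t = upper_cov I Cv Ct g \<cdot>\<^bsub>I\<^esub> upper_contr I Cv Ct f"
      and s: "s = lower_contr I Cv Ct g \<cdot>\<^bsub>I\<^esub> lower_cov I Cv Ct f"
    \<comment> \<open>\<open>t\<close> joins the targets and \<open>s\<close> the sources assigned
      to \<open>f\<close> and \<open>g\<close>; their factors therefore start or end exactly where
      \<open>Fm f\<close> and \<open>Fm g\<close> do.\<close>
    have tH: "t \<in> Hom I (var_target I Cv Ct f) (var_target I Cv Ct g)"
      unfolding t by (rule F.source.Comp_in_Hom[OF F.source.upper_factorization(4)[OF f]
        F.source.upper_factorization(3)[OF g]])
    have sH: "s \<in> Hom I (var_source I Cv Ct f) (var_source I Cv Ct g)"
      unfolding s by (rule F.source.Comp_in_Hom[OF F.source.lower_factorization(4)[OF f]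
        F.source.lower_factorization(3)[OF g]])
    note ut = F.source.upper_factorization[OF tH] and ls = F.source.lower_factorization[OF sH]
    show "Gm (Fm (g \<cdot>\<^bsub>I\<^esub> f)) =
      Gm (Fm (upper_cov I Cv Ct t)) \<cdot>\<^bsub>E\<^esub> Gm (Fm f) \<cdot>\<^bsub>E\<^esub>
        Gm (Fm (lower_contr I Cv Ct s))"
      unfolding F.Fm_Comp_first[OF f g t s]
      by (rule Gm3[OF contr[OF ls(2,3)] middle[OF f] cov[OF ut(1,3)]])
    show "Gm (Fm (g \<cdot>\<^bsub>I\<^esub> f)) =
      Gm (Fm (upper_contr I Cv Ct t)) \<cdot>\<^bsub>E\<^esub> Gm (Fm g) \<cdot>\<^bsub>E\<^esub>
        Gm (Fm (lower_cov I Cv Ct s))"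
      unfolding F.Fm_Comp_second[OF f g t s]
      by (rule Gm3[OF cov[OF ls(1,4)] middle[OF g] contr[OF ut(2,4)]])
  qed
qed

section \<open>Subobjects in slice categories\<close>

text \<open>On monomorphisms with a common codomain this is inclusion of subobjects, with the
  smaller one as first morphism argument.\<close>

definition factors_through :: "('o, 'm, 'z) category_scheme \<Rightarrow> 'm \<Rightarrow> 'm \<Rightarrow> bool" where
  "factors_through C g f \<longleftrightarrow> (\<exists>w \<in> Hom C (Dom C g) (Dom C f). f \<cdot>\<^bsub>C\<^esub> w = g)"

lemma slice_simps:
  "f \<in> Obj (slice C c) \<longleftrightarrow> f \<in> Hom C (Dom C f) c"
  "(f, u, g) \<in> Mor (slice C c) \<longleftrightarrow> f \<in> Hom C (Dom C f) c \<and>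
    g \<in> Hom C (Dom C g) c \<and>
    u \<in> Hom C (Dom C f) (Dom C g) \<and> g \<cdot>\<^bsub>C\<^esub> u = f"
  "Dom (slice C c) (f, u, g) = f" "Cod (slice C c) (f, u, g) = g"
  "Ident (slice C c) f = (f, Ident C (Dom C f), f)"
  "(g', v, h) \<cdot>\<^bsub>slice C c\<^esub> (f, u, g) = (f, v \<cdot>\<^bsub>C\<^esub> u, h)"
  by (auto simp: slice_def Hom_def)

lemma in_Hom_slice_iff:
  "k \<in> Hom (slice C c) f g \<longleftrightarrow> (\<exists>u. k = (f, u, g) \<and>
    (f, u, g) \<in> Mor (slice C c))"
  by (cases k) (auto simp: Hom_def slice_simps)

context category
begin

lemma category_slice: "category (slice C c)"
proof (rule category.intro)
  fix k assume k: "k \<in> Mor (slice C c)"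
  obtain f u g where kk: "k = (f, u, g)" by (cases k)
  show "Dom (slice C c) k \<in> Obj (slice C c)" "Cod (slice C c) k \<in> Obj (slice C c)"
    using k by (auto simp: kk slice_simps)
  show "k \<cdot>\<^bsub>slice C c\<^esub> Ident (slice C c) (Dom (slice C c) k) = k"
    "Ident (slice C c) (Cod (slice C c) k) \<cdot>\<^bsub>slice C c\<^esub> k = k"
    using k Comp_Ident[of u] by (auto simp: kk slice_simps)
next
  fix f assume "f \<in> Obj (slice C c)"
  then have f: "f \<in> Hom C (Dom C f) c" by (simp add: slice_simps)
  then show "Ident (slice C c) f \<in> Hom (slice C c) f f"
    using Ident_in_Hom[OF Hom_Obj(1)[OF f]] Comp_Ident[OF f]
    by (simp add: in_Hom_slice_iff slice_simps)
next
  fix k l f g h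
  assume "k \<in> Hom (slice C c) f g" "l \<in> Hom (slice C c) g h"
  then obtain u v where k: "k = (f, u, g)" "(f, u, g) \<in> Mor (slice C c)"
    and l: "l = (g, v, h)" "(g, v, h) \<in> Mor (slice C c)"
    by (auto simp: in_Hom_slice_iff)
  then have u: "u \<in> Hom C (Dom C f) (Dom C g)" and v: "v \<in> Hom C (Dom C g) (Dom C h)"
    and h: "h \<in> Hom C (Dom C h) c"
    by (auto simp: slice_simps)
  show "l \<cdot>\<^bsub>slice C c\<^esub> k \<in> Hom (slice C c) f h"
    using k l Comp_in_Hom[OF u v] Comp_assoc[OF u v h]
    by (auto simp: in_Hom_slice_iff slice_simps)
next
  fix k l m f g h p
  assume "k \<in> Hom (slice C c) f g" "l \<in> Hom (slice C c) g h" "m \<in> Hom (slice C c) h p"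
  then obtain u v w where "k = (f, u, g)" "(f, u, g) \<in> Mor (slice C c)"
    "l = (g, v, h)" "(g, v, h) \<in> Mor (slice C c)" "m = (h, w, p)" "(h, w, p) \<in> Mor (slice C c)"
    by (auto simp: in_Hom_slice_iff)
  then show "(m \<cdot>\<^bsub>slice C c\<^esub> l) \<cdot>\<^bsub>slice C c\<^esub> k =
    m \<cdot>\<^bsub>slice C c\<^esub> (l \<cdot>\<^bsub>slice C c\<^esub> k)"
    using Comp_assoc[of u _ _ v _ w] by (auto simp: slice_simps)
qed

text \<open>Subobjects form a preorder inside the slice, so equations between morphisms into a
  monomorphism hold automatically.\<close>

lemma Hom_slice_unique:
  assumes "monic C g" "k \<in> Hom (slice C c) f g" "l \<in> Hom (slice C c) f g"
  shows "k = l"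
proof -
  obtain u v where "k = (f, u, g)" "l = (f, v, g)"
    "u \<in> Hom C (Dom C f) (Dom C g)" "v \<in> Hom C (Dom C f) (Dom C g)"
    "g \<in> Hom C (Dom C g) c" "g \<cdot> u = f" "g \<cdot> v = f"
    using assms(2,3) by (auto simp: in_Hom_slice_iff slice_simps)
  then show ?thesis using monic_cancel[OF assms(1)] by metis
qed

text \<open>Between subobjects, arrows in both directions are mutually inverse by uniqueness.
  Invertibility thus becomes the reverse inclusion.\<close>

lemma isomorphism_slice_iff:
  assumes mor: "(f, u, g) \<in> Mor (slice C c)" and f: "monic C f" and g: "monic C g"
  shows "isomorphism (slice C c) (f, u, g) \<longleftrightarrow> factors_through C g f"
proof
  assume "isomorphism (slice C c) (f, u, g)"
  then show "factors_through C g f"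
    by (auto simp: isomorphism_def in_Hom_slice_iff slice_simps factors_through_def)
next
  assume "factors_through C g f"
  then obtain w where w: "w \<in> Hom C (Dom C g) (Dom C f)" "f \<cdot> w = g"
    by (auto simp: factors_through_def)
  then have inv: "(g, w, f) \<in> Hom (slice C c) g f"
    and fwd: "(f, u, g) \<in> Hom (slice C c) f g"
    using mor by (auto simp: in_Hom_slice_iff slice_simps)
  interpret S: category "slice C c" by (rule category_slice)
  note objs = S.Hom_Obj[OF fwd]
  have "(g, w, f) \<cdot>\<^bsub>slice C c\<^esub> (f, u, g) = Ident (slice C c) f"
    by (rule Hom_slice_unique[OF f S.Comp_in_Hom[OF fwd inv] S.Ident_in_Hom[OF objs(1)]])
  moreover have "(f, u, g) \<cdot>\<^bsub>slice C c\<^esub> (g, w, f) = Ident (slice C c) g"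
    by (rule Hom_slice_unique[OF g S.Comp_in_Hom[OF inv fwd] S.Ident_in_Hom[OF objs(2)]])
  ultimately show "isomorphism (slice C c) (f, u, g)"
    using mor inv unfolding isomorphism_def slice_simps(3,4) by blast
qed

text \<open>The action on morphisms is chosen arbitrarily from the factorizations given by
  \<open>mono\<close>; identities and composites are respected because all values of
  \<open>G\<close> are monic.\<close>

lemma ex_slice_functor:
  assumes monic: "\<And>x f. f \<in> Hom C x c \<Longrightarrow> monic C (G f) \<and> Cod C (G f) = d"
    and mono: "\<And>x y f g. f \<in> Hom C x c \<Longrightarrow> g \<in> Hom C y c \<Longrightarrow>
      factors_through C f g \<Longrightarrow>
      factors_through C (G f) (G g)"
  shows "\<exists>Gm. cat_functor (slice C c) (slice C d) G Gm"
proof -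
  interpret S: category "slice C c" by (rule category_slice)
  interpret T: category "slice C d" by (rule category_slice)
  have G_Hom: "monic C (G f)" "G f \<in> Hom C (Dom C (G f)) d" if "f \<in> Obj (slice C c)" for f
    using monic[of f "Dom C f"] that by (auto simp: slice_simps monic_def Hom_def)
  have "\<exists>l. l \<in> Hom (slice C d) (G (Dom (slice C c) k)) (G (Cod (slice C c) k))"
    if k: "k \<in> Mor (slice C c)" for k
  proof -
    obtain f u g where kk: "k = (f, u, g)" by (cases k)
    then have fg: "f \<in> Hom C (Dom C f) c" "g \<in> Hom C (Dom C g) c"
      "u \<in> Hom C (Dom C f) (Dom C g)" "g \<cdot> u = f"
      using k by (auto simp: slice_simps)
    have "factors_through C f g" using fg(3,4) by (auto simp: factors_through_def)
    then have "factors_through C (G f) (G g)" by (rule mono[OF fg(1,2)])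
    then show ?thesis
      using G_Hom[of f] G_Hom[of g] fg(1,2)
      by (auto simp: kk slice_simps in_Hom_slice_iff factors_through_def)
  qed
  then obtain Gm where Gm: "Gm k \<in> Hom (slice C d) (G (Dom (slice C c) k)) (G (Cod (slice C c) k))"
    if "k \<in> Mor (slice C c)" for k
    by metis
  have Gm_Hom: "Gm k \<in> Hom (slice C d) (G f) (G g)" if "k \<in> Hom (slice C c) f g" for k f g
    using Gm[of k] that by (auto simp: Hom_def)
  have "cat_functor (slice C c) (slice C d) G Gm"
  proof unfold_locales
    show G_Obj: "G f \<in> Obj (slice C d)" if "f \<in> Obj (slice C c)" for f
      using G_Hom[OF that] by (simp add: slice_simps)
    show "Gm (Ident (slice C c) f) = Ident (slice C d) (G f)" if f: "f \<in> Obj (slice C c)" for f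
      by (rule Hom_slice_unique[OF G_Hom(1)[OF f] Gm_Hom[OF S.Ident_in_Hom[OF f]]
        T.Ident_in_Hom[OF G_Obj[OF f]]])
    show "Gm (l \<cdot>\<^bsub>slice C c\<^esub> k) = Gm l \<cdot>\<^bsub>slice C d\<^esub> Gm k"
      if kl: "k \<in> Hom (slice C c) f g" "l \<in> Hom (slice C c) g h" for k l f g h
      by (rule Hom_slice_unique[OF G_Hom(1)[OF S.Hom_Obj(2)[OF kl(2)]]
        Gm_Hom[OF S.Comp_in_Hom[OF kl]] T.Comp_in_Hom[OF Gm_Hom[OF kl(1)] Gm_Hom[OF kl(2)]]])
  qed (rule Gm_Hom)
  then show ?thesis by blast
qed

text \<open>The endpoints of \<open>Fm k\<close> are values of \<open>Fo\<close> at the source and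
  target that the variance assigns to \<open>k\<close>, hence monic.\<close>

lemma covering_values:
  assumes "covering C J (monomorphisms C) c T Fo Fm" "diagram_type T" "k \<in> Mor (Shape T)"
  obtains f u g where "Fm k = (f, u, g)" "(f, u, g) \<in> Mor (slice C c)" "monic C f" "monic C g"
proof -
  interpret F: variance_functor "Shape T" "Cov T" "Contr T" "slice C c" Fo Fm
    using assms(1) by (simp add: covering_def)
  have k: "k \<in> Hom (Shape T) (Dom (Shape T) k) (Cod (Shape T) k)"
    using assms(3) by (simp add: Hom_def)
  have "var_source (Shape T) (Cov T) (Contr T) k \<in> Obj (Shape T)"
    "var_target (Shape T) (Cov T) (Contr T) k \<in> Obj (Shape T)"
    using F.source.lower_factorization(3)[OF k] F.source.upper_factorization(3)[OF k]
      F.source.Hom_Obj by blast+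
  then show ?thesis
    using F.Fm_in_Hom[OF assms(3)] assms(1) that
    by (auto simp: in_Hom_slice_iff covering_def monomorphisms_def)
qed

text \<open>Composition with the functor extending \<open>G\<close> gives a covering of
  \<open>d\<close> with the same diagram type. Compactness of \<open>d\<close> supplies the index,
  and of each isomorphism only the inverse arrow is kept.\<close>

lemma compact_object_slice_functor:
  assumes d: "compact_object C J (monomorphisms C) d"
    and F: "covering C J (monomorphisms C) c T Fo Fm" and T: "diagram_type T"
    and monic: "\<And>x f. f \<in> Hom C x c \<Longrightarrow> monic C (G f) \<and> Cod C (G f) = d"
    and mono: "\<And>x y f g. f \<in> Hom C x c \<Longrightarrow> g \<in> Hom C y c \<Longrightarrow>
      factors_through C f g \<Longrightarrow>
      factors_through C (G f) (G g)"
  obtains i\<^sub>0 where "i\<^sub>0 \<in> Small T"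
    "\<And>i j h k f u g. h \<in> Hom (Shape T) i\<^sub>0 i \<Longrightarrow> k \<in> Hom (Shape T) i j \<Longrightarrow>
      Fm k = (f, u, g) \<Longrightarrow>
      factors_through C (G g) (G f)"
proof -
  obtain Gm where Gm: "cat_functor (slice C c) (slice C d) G Gm"
    using ex_slice_functor[of c G d] monic mono by blast
  interpret G: cat_functor "slice C c" "slice C d" G Gm by (rule Gm)
  have cov: "covering C J (monomorphisms C) d T (\<lambda>i. G (Fo i)) (\<lambda>k. Gm (Fm k))"
  proof -
    interpret F: variance_functor "Shape T" "Cov T" "Contr T" "slice C c" Fo Fm
      using F by (simp add: covering_def)
    have "monic C (G (Fo i))" if "i \<in> Obj (Shape T)" for i
      using monic F.Fo_in_Obj[OF that] by (auto simp: slice_simps)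
    then show ?thesis
      using F variance_functor_comp[OF F.variance_functor_axioms Gm]
      by (simp add: covering_def monomorphisms_def)
  qed
  then obtain i\<^sub>0 where i\<^sub>0: "i\<^sub>0 \<in> Small T"
    "\<And>i j h k. h \<in> Hom (Shape T) i\<^sub>0 i \<Longrightarrow>
      k \<in> Hom (Shape T) i j \<Longrightarrow>
      isomorphism (slice C d) (Gm (Fm k))"
    using d unfolding compact_object_def by meson
  show ?thesis
  proof (rule that[OF i\<^sub>0(1)])
    fix i j h k f u g
    assume h: "h \<in> Hom (Shape T) i\<^sub>0 i" and k: "k \<in> Hom (Shape T) i j" and Fk: "Fm k = (f, u, g)"
    have kM: "k \<in> Mor (Shape T)" using k by (simp add: Hom_def)
    have "Fm k \<in> Hom (slice C c) f g"
      using covering_values[OF F T kM] Fk by (auto simp: in_Hom_slice_iff)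
    then have "Gm (Fm k) \<in> Hom (slice C d) (G f) (G g)" by (rule G.Fm_in_Hom)
    then obtain v where "Gm (Fm k) = (G f, v, G g)" by (auto simp: in_Hom_slice_iff)
    moreover have "isomorphism (slice C d) (Gm (Fm k))" by (rule i\<^sub>0(2)[OF h k])
    ultimately show "factors_through C (G g) (G f)"
      by (auto simp: isomorphism_def in_Hom_slice_iff slice_simps factors_through_def)
  qed
qed

lemma compact_objectI:
  fixes J :: "('i, 'j) diagram_type set"
  assumes "c \<in> Obj C" and "\<And>T. T \<in> J \<Longrightarrow> diagram_type T"
    and "\<And>T Fo Fm. T \<in> J \<Longrightarrow> covering C J (monomorphisms C) c T Fo Fm \<Longrightarrow>
      \<exists>i\<^sub>0 \<in> Small T. \<forall>i j. \<forall>h \<in> Hom (Shape T) i\<^sub>0 i. \<forall>k \<in> Hom (Shape T) i j. \<forall>f u g.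
        Fm k = (f, u, g) \<longrightarrow> (f, u, g) \<in> Mor (slice C c) \<longrightarrow> monic C f \<longrightarrow> monic C g \<longrightarrow>
        factors_through C g f"
  shows "compact_object C J (monomorphisms C) c"
  unfolding compact_object_def
proof (intro conjI allI impI)
  show "c \<in> Obj C" by fact
  fix T :: "('i, 'j) diagram_type" and Fo Fm
  assume F: "covering C J (monomorphisms C) c T Fo Fm"
  then have T: "T \<in> J" "diagram_type T" using assms(2) by (auto simp: covering_def)
  obtain i\<^sub>0 where i\<^sub>0: "i\<^sub>0 \<in> Small T"
    "\<And>i j h k f u g. h \<in> Hom (Shape T) i\<^sub>0 i \<Longrightarrow> k \<in> Hom (Shape T) i j \<Longrightarrow>
      Fm k = (f, u, g) \<Longrightarrow>
      (f, u, g) \<in> Mor (slice C c) \<Longrightarrow> monic C f \<Longrightarrow> monic C g \<Longrightarrow>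
        factors_through C g f"
    using assms(3)[OF T(1) F] by blast
  have "isomorphism (slice C c) (Fm k)"
    if h: "h \<in> Hom (Shape T) i\<^sub>0 i" and k: "k \<in> Hom (Shape T) i j" for i j h k
  proof -
    have kM: "k \<in> Mor (Shape T)" using k by (simp add: Hom_def)
    obtain f u g where Fk: "Fm k = (f, u, g)" and fug: "(f, u, g) \<in> Mor (slice C c)"
      and fg: "monic C f" "monic C g"
      by (rule covering_values[OF F T(2) kM])
    show ?thesis
      unfolding Fk isomorphism_slice_iff[OF fug fg] by (rule i\<^sub>0(2)[OF h k Fk fug fg])
  qed
  then show "\<exists>i\<^sub>0 \<in> Small T. \<forall>i j. \<forall>h \<in> Hom (Shape T) i\<^sub>0 i. \<forall>k \<in> Hom (Shape T) i j.
      isomorphism (slice C c) (Fm k)"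
    using i\<^sub>0(1) by blast
qed

end

section \<open>Closure properties of compact objects\<close>

text \<open>For \<open>p : c \<rightarrow> b\<close> and \<open>q : d \<rightarrow> b\<close> this is the subobject \<open>q\<^sup>-\<^sup>1(p(im f))\<close> of \<open>d\<close>.\<close>

definition image_preimage ::
    "('o, 'm, 'z) preadditive_category_scheme \<Rightarrow> 'm \<Rightarrow> 'm \<Rightarrow> 'm \<Rightarrow> 'm" where
  "image_preimage C p q f =
    (SOME k. is_kernel C k ((SOME r. is_cokernel C r (p \<cdot>\<^bsub>C\<^esub> f)) \<cdot>\<^bsub>C\<^esub> q))"

context abelian_category
begin

text \<open>Resolves the two choices in the definition. The kernel of \<open>r\<close> is the image
  of \<open>p \<cdot> f\<close>, so the kernel of \<open>r \<cdot> q\<close> is its preimage under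
  \<open>q\<close>.\<close>

lemma image_preimageE:
  assumes f: "f \<in> Hom C x c" and p: "p \<in> Hom C c b" and q: "q \<in> Hom C d b"
  obtains r v where "is_cokernel C r (p \<cdot> f)" "r \<in> Hom C b v"
    "is_kernel C (image_preimage C p q f) (r \<cdot> q)"
proof -
  define r where "r = (SOME r. is_cokernel C r (p \<cdot> f))"
  have pf: "p \<cdot> f \<in> Hom C x b" by (rule Comp_in_Hom[OF f p])
  then have r: "is_cokernel C r (p \<cdot> f)"
    unfolding r_def using ex_cokernel someI_ex[of "\<lambda>r. is_cokernel C r (p \<cdot> f)"]
    by (auto simp: Hom_def)
  then obtain v where v: "r \<in> Hom C b v" by (rule cokernelE[OF _ pf])
  have "r \<cdot> q \<in> Mor C" using Comp_in_Hom[OF q v] by (simp add: Hom_def)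
  then have "is_kernel C (image_preimage C p q f) (r \<cdot> q)"
    unfolding image_preimage_def r_def[symmetric] by (rule someI_ex[OF ex_kernel])
  then show ?thesis by (rule that[OF r v])
qed

lemma image_preimage_monic:
  assumes "f \<in> Hom C x c" "p \<in> Hom C c b" "q \<in> Hom C d b"
  shows "monic C (image_preimage C p q f) \<and> Cod C (image_preimage C p q f) = d"
proof -
  obtain r v where r: "r \<in> Hom C b v" and k: "is_kernel C (image_preimage C p q f) (r \<cdot> q)"
    by (rule image_preimageE[OF assms])
  show ?thesis
    by (rule kernelE[OF k Comp_in_Hom[OF assms(3) r]]) (simp add: Hom_def)
qed

text \<open>If \<open>f\<close> factors through \<open>g\<close>, the cokernel \<open>s\<close> of
  \<open>p \<cdot> g\<close> also kills \<open>p \<cdot> f\<close>, so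
  \<open>s = t \<cdot> r\<close>. Whatever \<open>r \<cdot> q\<close> kills is then killed by
  \<open>s \<cdot> q\<close>.\<close>

lemma image_preimage_mono:
  assumes f: "f \<in> Hom C x c" and g: "g \<in> Hom C y c" and p: "p \<in> Hom C c b"
    and q: "q \<in> Hom C d b" and fg: "factors_through C f g"
  shows "factors_through C (image_preimage C p q f) (image_preimage C p q g)"
proof -
  let ?k = "image_preimage C p q f" and ?l = "image_preimage C p q g"
  obtain r v where r: "is_cokernel C r (p \<cdot> f)" "r \<in> Hom C b v" "is_kernel C ?k (r \<cdot> q)"
    by (rule image_preimageE[OF f p q])
  obtain s w where s: "is_cokernel C s (p \<cdot> g)" "s \<in> Hom C b w" "is_kernel C ?l (s \<cdot> q)"
    by (rule image_preimageE[OF g p q])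
  obtain u where u: "u \<in> Hom C x y" "g \<cdot> u = f"
    using fg f g by (auto simp: factors_through_def Hom_def)
  note pf = Comp_in_Hom[OF f p] and pg = Comp_in_Hom[OF g p]
    and rq = Comp_in_Hom[OF q r(2)] and sq = Comp_in_Hom[OF q s(2)]
  have x: "x \<in> Obj C" and w: "w \<in> Obj C" using Hom_Obj[OF f] Hom_Obj[OF s(2)] by auto
  obtain v' where r_factor: "r \<in> Hom C b v'"
      "\<And>z h. h \<in> Hom C b z \<Longrightarrow> h \<cdot> (p \<cdot> f) = HomZero C x z \<Longrightarrow>
        \<exists>t \<in> Hom C v' z. t \<cdot> r = h"
    by (rule cokernelE[OF r(1) pf]) blast
  then have v': "v' = v" using r(2) by (simp add: Hom_def)
  obtain w' where "s \<in> Hom C b w'" and spg: "s \<cdot> (p \<cdot> g) = HomZero C y w'"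
    by (rule cokernelE[OF s(1) pg])
  then have w': "w' = w" using s(2) by (simp add: Hom_def)
  have "s \<cdot> (p \<cdot> f) = (s \<cdot> (p \<cdot> g)) \<cdot> u"
    using Comp_assoc[OF u(1) g p] Comp_assoc[OF u(1) pg s(2)] u(2) by simp
  then have "s \<cdot> (p \<cdot> f) = HomZero C x w" using spg w' Comp_zero_left[OF u(1) w] by simp
  then obtain t where t: "t \<in> Hom C v w" "t \<cdot> r = s" using r_factor(2)[OF s(2)] v' by blast
  obtain m where k: "?k \<in> Hom C m d" "(r \<cdot> q) \<cdot> ?k = HomZero C m v"
    by (rule kernelE[OF r(3) rq])
  obtain n where l: "?l \<in> Hom C n d"
    and l_factor: "\<And>z h. h \<in> Hom C z d \<Longrightarrow> (s \<cdot> q) \<cdot> h =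
      HomZero C z w \<Longrightarrow>
      \<exists>t \<in> Hom C z n. ?l \<cdot> t = h"
    by (rule kernelE[OF s(3) sq]) blast
  have "(s \<cdot> q) \<cdot> ?k = t \<cdot> ((r \<cdot> q) \<cdot> ?k)"
    using Comp_assoc[OF q r(2) t(1)] Comp_assoc[OF k(1) rq t(1)] t(2) by simp
  also have "\<dots> = HomZero C m w"
    using k(2) Comp_zero_right[OF t(1)] Hom_Obj[OF k(1)] by simp
  finally show ?thesis
    using l_factor[OF k(1)] k(1) l by (auto simp: factors_through_def Hom_def)
qed

text \<open>A monomorphism is the kernel of its cokernel, so inclusion in \<open>f\<close> turns
  into an equation.\<close>

lemma monic_factors_through_iff:
  assumes f: "f \<in> Hom C x c" "monic C f" and g: "g \<in> Hom C y c"
    and r: "is_cokernel C r f" "r \<in> Hom C c v"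
  shows "factors_through C g f \<longleftrightarrow> r \<cdot> g = HomZero C y v"
proof -
  obtain v' where "r \<in> Hom C c v'" "r \<cdot> f = HomZero C x v'" by (rule cokernelE[OF r(1) f(1)])
  then have rf: "r \<cdot> f = HomZero C x v" using r(2) by (simp add: Hom_def)
  have "is_kernel C f r" by (rule monic_is_kernel_of_cokernel[OF f(2) r(1)])
  then obtain x' where "f \<in> Hom C x' c"
    and factor: "\<And>z h. h \<in> Hom C z c \<Longrightarrow> r \<cdot> h = HomZero C z v \<Longrightarrow>
      \<exists>u \<in> Hom C z x'. f \<cdot> u = h"
    by (rule kernelE[OF _ r(2)]) blast
  then have x': "x' = x" using f by (simp add: Hom_def)
  have dom: "Dom C f = x" "Dom C g = y" using f g by (auto simp: Hom_def)
  have "r \<cdot> (f \<cdot> w) = HomZero C y v" if "w \<in> Hom C y x" for w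
    using Comp_assoc[OF that f(1) r(2)] rf Comp_zero_left[OF that] Hom_Obj[OF r(2)] by simp
  then show ?thesis
    using factor[OF g] x' by (auto simp: factors_through_def dom)
qed

text \<open>Let \<open>r\<close> and \<open>s\<close> be cokernels of \<open>f\<close> and
  \<open>g\<close>. By \<open>le\<close>, \<open>r \<cdot> q\<close> kills the kernel of the
  epimorphism \<open>s \<cdot> q\<close>, so \<open>r \<cdot> q = t \<cdot> s \<cdot> q\<close>.
  Cancelling \<open>q\<close> gives \<open>r = t \<cdot> s\<close>, which kills
  \<open>g\<close>.\<close>

lemma factors_through_of_preimage:
  assumes q: "q \<in> Hom C d b" "epic C q" and f: "f \<in> Hom C x b" "monic C f" and g: "g \<in> Hom C y b"
    and le: "factors_through C (image_preimage C (Ident C b) q g) (image_preimage C (Ident C b) q f)"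
  shows "factors_through C g f"
proof -
  let ?k = "image_preimage C (Ident C b) q f" and ?l = "image_preimage C (Ident C b) q g"
  have b: "Ident C b \<in> Hom C b b" using Hom_Obj[OF q(1)] by (simp add: Ident_in_Hom)
  obtain r v where "is_cokernel C r (Ident C b \<cdot> f)" and rH: "r \<in> Hom C b v"
    and k: "is_kernel C ?k (r \<cdot> q)"
    by (rule image_preimageE[OF f(1) b q(1)])
  then have r: "is_cokernel C r f" using Comp_Ident[OF f(1)] by simp
  obtain s w where "is_cokernel C s (Ident C b \<cdot> g)" and sH: "s \<in> Hom C b w"
    and l: "is_kernel C ?l (s \<cdot> q)"
    by (rule image_preimageE[OF g b q(1)])
  then have s: "is_cokernel C s g" using Comp_Ident[OF g] by simp
  note rq = Comp_in_Hom[OF q(1) rH] and sq = Comp_in_Hom[OF q(1) sH]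
  obtain m where kH: "?k \<in> Hom C m d" "(r \<cdot> q) \<cdot> ?k = HomZero C m v"
    by (rule kernelE[OF k rq])
  obtain n where lH: "?l \<in> Hom C n d" by (rule kernelE[OF l sq])
  obtain u where u: "u \<in> Hom C n m" "?k \<cdot> u = ?l"
    using le kH lH by (auto simp: factors_through_def Hom_def)
  have objs: "v \<in> Obj C" "w \<in> Obj C" "y \<in> Obj C"
    using Hom_Obj[OF rH] Hom_Obj[OF sH] Hom_Obj[OF g] by auto
  have rql: "(r \<cdot> q) \<cdot> ?l = HomZero C n v"
    using Comp_assoc[OF u(1) kH(1) rq] u(2) kH(2) Comp_zero_left[OF u(1) objs(1)] by simp
  interpret op: abelian_category "opposite C" by (rule abelian_category_opposite)
  have "epic C s" by (rule cokernelE[OF s g])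
  then have "epic C (s \<cdot> q)"
    using op.monic_Comp[of s q w b d] q sH by simp
  then have "is_cokernel C (s \<cdot> q) ?l" by (rule epic_is_cokernel_of_kernel[OF _ l])
  then obtain w' where "s \<cdot> q \<in> Hom C d w'" and sq_factor:
    "\<And>z h. h \<in> Hom C d z \<Longrightarrow> h \<cdot> ?l = HomZero C n z \<Longrightarrow>
      \<exists>t \<in> Hom C w' z. t \<cdot> (s \<cdot> q) = h"
    by (rule cokernelE[OF _ lH]) blast
  then have "w' = w" using sq by (simp add: Hom_def)
  then obtain t where t: "t \<in> Hom C w v" "t \<cdot> (s \<cdot> q) = r \<cdot> q"
    using sq_factor[OF rq rql] by blast
  then have "(t \<cdot> s) \<cdot> q = r \<cdot> q" using Comp_assoc[OF q(1) sH t(1)] by simp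
  then have ts: "t \<cdot> s = r"
    using op.monic_cancel[of q b d "t \<cdot> s" v r] q rH Comp_in_Hom[OF sH t(1)] by simp
  obtain w'' where "s \<in> Hom C b w''" "s \<cdot> g = HomZero C y w''" by (rule cokernelE[OF s g])
  then have "s \<cdot> g = HomZero C y w" using sH by (simp add: Hom_def)
  then have "r \<cdot> g = HomZero C y v"
    using Comp_assoc[OF g sH t(1)] ts Comp_zero_right[OF t(1) objs(3)] by simp
  then show ?thesis by (simp add: monic_factors_through_iff[OF f g r rH])
qed

text \<open>For \<open>q = id\<close> the construction is the kernel of the cokernel of
  \<open>p \<cdot> f\<close>, that is, its image.\<close>

lemma image_preimage_Ident_factorization:
  assumes f: "f \<in> Hom C x c" and p: "p \<in> Hom C c b"
  obtains w e where "image_preimage C p (Ident C b) f \<in> Hom C w b"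
    "monic C (image_preimage C p (Ident C b) f)" "e \<in> Hom C x w" "epic C e"
    "image_preimage C p (Ident C b) f \<cdot> e = p \<cdot> f"
proof -
  let ?n = "image_preimage C p (Ident C b) f"
  have b: "Ident C b \<in> Hom C b b" using Hom_Obj[OF p] by (simp add: Ident_in_Hom)
  obtain r v where r: "is_cokernel C r (p \<cdot> f)" "r \<in> Hom C b v"
    and "is_kernel C ?n (r \<cdot> Ident C b)"
    by (rule image_preimageE[OF f p b])
  then have "is_kernel C ?n r" using Comp_Ident[OF r(2)] by simp
  then show ?thesis
    by (rule image_factorization[OF Comp_in_Hom[OF f p] r(1)]) (rule that)
qed

text \<open>Let \<open>g \<cdot> u = f\<close> and \<open>h = coker u\<close>. The hypothesis \<open>ker\<close> makes \<open>h\<close> vanish on the part of \<open>g\<close> lying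
  in \<open>ker p\<close>, so \<open>h\<close> descends to the image of \<open>p \<cdot> g\<close>, where it vanishes by \<open>img\<close>.\<close>

lemma factors_through_of_kernel_and_image:
  assumes p: "p \<in> Hom C c b" and i: "is_kernel C i p" "i \<in> Hom C a c"
    and f: "f \<in> Hom C x c" "monic C f" and g: "g \<in> Hom C y c" "monic C g"
    and fg: "factors_through C f g"
    and ker: "factors_through C (image_preimage C (Ident C c) i g) (image_preimage C (Ident C c) i f)"
    and img: "factors_through C (image_preimage C p (Ident C b) g) (image_preimage C p (Ident C b) f)"
  shows "factors_through C g f"
proof -
  have c: "Ident C c \<in> Hom C c c" and b: "Ident C b \<in> Hom C b b"
    using Hom_Obj[OF p] by (simp_all add: Ident_in_Hom)
  obtain u where u: "u \<in> Hom C x y" "g \<cdot> u = f"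
    using fg f(1) g(1) by (auto simp: factors_through_def Hom_def)
  have "monic C (g \<cdot> u)" using u(2) f(2) by simp
  then have u_monic: "monic C u" by (rule monic_right_factor[OF _ u(1) g(1)])
  obtain h where h: "is_cokernel C h u" using ex_cokernel u(1) by (auto simp: Hom_def)
  then obtain s where hH: "h \<in> Hom C y s" and hu: "h \<cdot> u = HomZero C x s"
    by (rule cokernelE[OF _ u(1)])
  have objs: "x \<in> Obj C" "y \<in> Obj C" "s \<in> Obj C"
    using Hom_Obj[OF u(1)] Hom_Obj[OF hH] by auto

  have vanish: "h \<cdot> t = HomZero C z s" if t: "t \<in> Hom C z y" and pgt: "p \<cdot> (g \<cdot> t) =
    HomZero C z b" for z t
  proof -
    let ?k = "image_preimage C (Ident C c) i f" and ?l = "image_preimage C (Ident C c) i g"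
    obtain r v where "is_cokernel C r (Ident C c \<cdot> f)" and rH: "r \<in> Hom C c v"
      and k: "is_kernel C ?k (r \<cdot> i)"
      by (rule image_preimageE[OF f(1) c i(2)])
    then have r: "is_cokernel C r f" using Comp_Ident[OF f(1)] by simp
    obtain q w where "is_cokernel C q (Ident C c \<cdot> g)" and qH: "q \<in> Hom C c w"
      and l: "is_kernel C ?l (q \<cdot> i)"
      by (rule image_preimageE[OF g(1) c i(2)])
    then have q: "is_cokernel C q g" using Comp_Ident[OF g(1)] by simp
    obtain m where kH: "?k \<in> Hom C m a" "(r \<cdot> i) \<cdot> ?k = HomZero C m v"
      by (rule kernelE[OF k Comp_in_Hom[OF i(2) rH]])
    obtain n where lH: "?l \<in> Hom C n a"
      and l_factor: "\<And>z j. j \<in> Hom C z a \<Longrightarrow> (q \<cdot> i) \<cdot> j =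
        HomZero C z w \<Longrightarrow> \<exists>j' \<in> Hom C z n. ?l \<cdot> j' = j"
      by (rule kernelE[OF l Comp_in_Hom[OF i(2) qH]]) blast
    note ik = Comp_in_Hom[OF kH(1) i(2)] and gt = Comp_in_Hom[OF t g(1)]
    have "r \<cdot> (i \<cdot> ?k) = HomZero C m v" using Comp_assoc[OF kH(1) i(2) rH] kH(2) by simp
    then have "factors_through C (i \<cdot> ?k) f"
      by (simp add: monic_factors_through_iff[OF f ik r rH])
    \<comment> \<open>\<open>\<alpha>\<close> is the restriction of \<open>i\<close> to a map from
      the preimage of \<open>f\<close> into \<open>f\<close>.\<close>
    then obtain \<alpha> where \<alpha>: "\<alpha> \<in> Hom C m x" "f \<cdot> \<alpha> = i \<cdot> ?k"
      using f(1) ik by (auto simp: factors_through_def Hom_def)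
    obtain v' where v': "v' \<in> Hom C n m" "?k \<cdot> v' = ?l"
      using ker kH(1) lH by (auto simp: factors_through_def Hom_def)
    obtain a' where "i \<in> Hom C a' c"
      and i_factor: "\<exists>j \<in> Hom C z a'. i \<cdot> j = g \<cdot> t"
      using kernelE[OF i(1) p] gt pgt by metis
    then obtain j where j: "j \<in> Hom C z a" "i \<cdot> j = g \<cdot> t"
      using i(2) by (auto simp: Hom_def)
    have "factors_through C (g \<cdot> t) g"
      using t g(1) gt by (auto simp: factors_through_def Hom_def)
    then have "q \<cdot> (g \<cdot> t) = HomZero C z w"
      by (simp add: monic_factors_through_iff[OF g gt q qH])
    then have "(q \<cdot> i) \<cdot> j = HomZero C z w" using Comp_assoc[OF j(1) i(2) qH] j(2) by simp
    then obtain j' where j': "j' \<in> Hom C z n" "?l \<cdot> j' = j" using l_factor[OF j(1)] by blast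
    \<comment> \<open>\<open>j\<close> is \<open>g \<cdot> t\<close> viewed in the kernel of
      \<open>p\<close>. It lies in the preimage of \<open>g\<close> through \<open>j'\<close>, and
      \<open>v'\<close>, obtained from \<open>ker\<close>, moves it into the preimage of
      \<open>f\<close>.\<close>
    define \<beta> where "\<beta> = v' \<cdot> j'"
    have \<beta>: "\<beta> \<in> Hom C z m" "?k \<cdot> \<beta> = j"
      using Comp_in_Hom[OF j'(1) v'(1)] Comp_assoc[OF j'(1) v'(1) kH(1)] v'(2) j'(2)
      by (simp_all add: \<beta>_def)
    note \<alpha>\<beta> = Comp_in_Hom[OF \<beta>(1) \<alpha>(1)]
    \<comment> \<open>Comparing after the monic \<open>g\<close> shows that \<open>t\<close> factors
      through \<open>u\<close>, which \<open>h\<close> kills.\<close>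
    have "g \<cdot> (u \<cdot> (\<alpha> \<cdot> \<beta>)) = f \<cdot> (\<alpha> \<cdot> \<beta>)"
      using Comp_assoc[OF \<alpha>\<beta> u(1) g(1)] u(2) by simp
    also have "\<dots> = i \<cdot> j"
      using Comp_assoc[OF \<beta>(1) \<alpha>(1) f(1)] Comp_assoc[OF \<beta>(1) kH(1) i(2)] \<alpha>(2) \<beta>(2) by simp
    finally have "u \<cdot> (\<alpha> \<cdot> \<beta>) = t"
      using monic_cancel[OF g(2,1) Comp_in_Hom[OF \<alpha>\<beta> u(1)] t] j(2) by simp
    then show ?thesis
      using Comp_assoc[OF \<alpha>\<beta> u(1) hH] hu Comp_zero_left[OF \<alpha>\<beta> objs(3)] by simp
  qed

  let ?n\<^sub>f = "image_preimage C p (Ident C b) f" and ?n\<^sub>g = "image_preimage C p (Ident C b) g"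
  obtain w\<^sub>f e\<^sub>f where nf: "?n\<^sub>f \<in> Hom C w\<^sub>f b"
    and ef: "e\<^sub>f \<in> Hom C x w\<^sub>f" "epic C e\<^sub>f" "?n\<^sub>f \<cdot> e\<^sub>f = p \<cdot> f"
    by (rule image_preimage_Ident_factorization[OF f(1) p])
  obtain w\<^sub>g e\<^sub>g where ng: "?n\<^sub>g \<in> Hom C w\<^sub>g b" "monic C ?n\<^sub>g"
    and eg: "e\<^sub>g \<in> Hom C y w\<^sub>g" "epic C e\<^sub>g" "?n\<^sub>g \<cdot> e\<^sub>g = p \<cdot> g"
    by (rule image_preimage_Ident_factorization[OF g(1) p])
  have w\<^sub>g: "w\<^sub>g \<in> Obj C" and w\<^sub>f: "w\<^sub>f \<in> Obj C"
    using Hom_Obj[OF ng(1)] Hom_Obj[OF nf] by auto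
  \<comment> \<open>\<open>\<kappa>\<close> is the kernel of the projection onto the image of
    \<open>p \<cdot> g\<close>. By \<open>vanish\<close> it is killed by \<open>h\<close>, which
    gives the descended map \<open>\<omega>\<close>.\<close>
  obtain \<kappa> where \<kappa>: "is_kernel C \<kappa> e\<^sub>g" using ex_kernel eg(1) by (auto simp: Hom_def)
  then obtain d where \<kappa>H: "\<kappa> \<in> Hom C d y" and e\<kappa>: "e\<^sub>g \<cdot> \<kappa> =
    HomZero C d w\<^sub>g"
    by (rule kernelE[OF _ eg(1)])
  have "p \<cdot> (g \<cdot> \<kappa>) = ?n\<^sub>g \<cdot> (e\<^sub>g \<cdot> \<kappa>)"
    using Comp_assoc[OF \<kappa>H g(1) p] Comp_assoc[OF \<kappa>H eg(1) ng(1)] eg(3) by simp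
  then have "p \<cdot> (g \<cdot> \<kappa>) = HomZero C d b"
    using e\<kappa> Comp_zero_right[OF ng(1)] Hom_Obj[OF \<kappa>H] by simp
  then have h\<kappa>: "h \<cdot> \<kappa> = HomZero C d s" by (rule vanish[OF \<kappa>H])
  have "is_cokernel C e\<^sub>g \<kappa>" by (rule epic_is_cokernel_of_kernel[OF eg(2) \<kappa>])
  then obtain w' where "e\<^sub>g \<in> Hom C y w'" and
    eg_factor: "\<And>z h. h \<in> Hom C y z \<Longrightarrow> h \<cdot> \<kappa> = HomZero C d z \<Longrightarrow>
      \<exists>t \<in> Hom C w' z. t \<cdot> e\<^sub>g = h"
    by (rule cokernelE[OF _ \<kappa>H]) blast
  then have "w' = w\<^sub>g" using eg(1) by (simp add: Hom_def)
  then obtain \<omega> where \<omega>: "\<omega> \<in> Hom C w\<^sub>g s" "\<omega> \<cdot> e\<^sub>g =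
    h" using eg_factor[OF hH h\<kappa>] by blast
  have "factors_through C ?n\<^sub>f ?n\<^sub>g" by (rule image_preimage_mono[OF f(1) g(1) p b fg])
  \<comment> \<open>\<open>\<phi>\<close> is the inclusion of the image of
    \<open>p \<cdot> f\<close> into that of \<open>p \<cdot> g\<close>; the map
    \<open>\<psi>\<close> coming from \<open>img\<close> will be a right inverse of it.\<close>
  then obtain \<phi> where \<phi>: "\<phi> \<in> Hom C w\<^sub>f w\<^sub>g" "?n\<^sub>g \<cdot> \<phi> =
    ?n\<^sub>f"
    using nf ng(1) by (auto simp: factors_through_def Hom_def)
  obtain \<psi> where \<psi>: "\<psi> \<in> Hom C w\<^sub>g w\<^sub>f" "?n\<^sub>f \<cdot> \<psi> = ?n\<^sub>g"
    using img nf ng(1) by (auto simp: factors_through_def Hom_def)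
  have "?n\<^sub>g \<cdot> (e\<^sub>g \<cdot> u) = ?n\<^sub>g \<cdot> (\<phi> \<cdot> e\<^sub>f)"
    using Comp_assoc[OF u(1) eg(1) ng(1)] Comp_assoc[OF ef(1) \<phi>(1) ng(1)]
      Comp_assoc[OF u(1) g(1) p] eg(3) ef(3) \<phi>(2) u(2) by simp
  then have "e\<^sub>g \<cdot> u = \<phi> \<cdot> e\<^sub>f"
    by (rule monic_cancel[OF ng(2,1) Comp_in_Hom[OF u(1) eg(1)] Comp_in_Hom[OF ef(1) \<phi>(1)]])
  \<comment> \<open>Both sides are zero, because
    \<open>\<omega> \<cdot> e\<^sub>g \<cdot> u = h \<cdot> u = 0\<close>. The epimorphism
    \<open>e\<^sub>f\<close> is then cancelled in the opposite category.\<close>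
  then have "(\<omega> \<cdot> \<phi>) \<cdot> e\<^sub>f = HomZero C w\<^sub>f s \<cdot> e\<^sub>f"
    using Comp_assoc[OF ef(1) \<phi>(1) \<omega>(1)] Comp_assoc[OF u(1) eg(1) \<omega>(1)] \<omega>(2) hu
      Comp_zero_left[OF ef(1) objs(3)] by simp
  then have \<omega>\<phi>: "\<omega> \<cdot> \<phi> = HomZero C w\<^sub>f s"
    using category.monic_cancel[of "opposite C" e\<^sub>f w\<^sub>f x "\<omega> \<cdot> \<phi>" s] ef
      preadditive_category.axioms(1)[OF preadditive_category_opposite]
      Comp_in_Hom[OF \<phi>(1) \<omega>(1)] HomZero_in_Hom[OF w\<^sub>f objs(3)] by simp
  have "?n\<^sub>g \<cdot> (\<phi> \<cdot> \<psi>) = ?n\<^sub>g \<cdot> Ident C w\<^sub>g"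
    using Comp_assoc[OF \<psi>(1) \<phi>(1) ng(1)] \<phi>(2) \<psi>(2) Comp_Ident[OF ng(1)] by simp
  then have "\<phi> \<cdot> \<psi> = Ident C w\<^sub>g"
    by (rule monic_cancel[OF ng(2,1) Comp_in_Hom[OF \<psi>(1) \<phi>(1)] Ident_in_Hom[OF w\<^sub>g]])
  then have "\<omega> = HomZero C w\<^sub>g s"
    using Comp_assoc[OF \<psi>(1) \<phi>(1) \<omega>(1)] \<omega>\<phi> Comp_zero_left[OF \<psi>(1) objs(3)] Comp_Ident[OF \<omega>(1)]
    by simp
  \<comment> \<open>So \<open>h = 0\<close>: the cokernel of the monic \<open>u\<close> vanishes,
    and the identity of \<open>y\<close> factors through \<open>u\<close>.\<close>
  then have "h \<cdot> Ident C y = HomZero C y s"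
    using \<omega>(2) Comp_zero_left[OF eg(1) objs(3)] Comp_Ident[OF hH] by simp
  then have "factors_through C (Ident C y) u"
    by (simp add: monic_factors_through_iff[OF u(1) u_monic Ident_in_Hom[OF objs(2)] h hH])
  then obtain z where z: "z \<in> Hom C y x" "u \<cdot> z = Ident C y"
    using u(1) Ident_in_Hom[OF objs(2)] by (auto simp: factors_through_def Hom_def)
  have "f \<cdot> z = g" using Comp_assoc[OF z(1) u(1) g(1)] u(2) z(2) Comp_Ident[OF g(1)] by simp
  then show ?thesis using z(1) f(1) g(1) by (auto simp: factors_through_def Hom_def)
qed

lemma compact_object_image_preimage:
  assumes d: "compact_object C J (monomorphisms C) d"
    and F: "covering C J (monomorphisms C) c T Fo Fm" and T: "diagram_type T"
    and p: "p \<in> Hom C c b" and q: "q \<in> Hom C d b"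
  obtains i\<^sub>0 where "i\<^sub>0 \<in> Small T"
    "\<And>i j h k f u g. h \<in> Hom (Shape T) i\<^sub>0 i \<Longrightarrow> k \<in> Hom (Shape T) i j \<Longrightarrow>
      Fm k = (f, u, g) \<Longrightarrow>
      factors_through C (image_preimage C p q g) (image_preimage C p q f)"
proof (rule compact_object_slice_functor[OF d F T, where G = "image_preimage C p q"])
  show "monic C (image_preimage C p q f) \<and> Cod C (image_preimage C p q f) = d"
    if "f \<in> Hom C x c" for x f
    by (rule image_preimage_monic[OF that p q])
  show "factors_through C (image_preimage C p q f) (image_preimage C p q g)"
    if "f \<in> Hom C x c" "g \<in> Hom C y c" "factors_through C f g" for x y f g
    by (rule image_preimage_mono[OF that(1,2) p q that(3)])
qed (rule that)

section \<open>Closure properties for a fixed class of diagram types\<close>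

context
  fixes J :: "('i, 'j) diagram_type set"
  assumes J: "\<And>T. T \<in> J \<Longrightarrow> diagram_type T"
begin

text \<open>Morphisms into a zero object agree, so any two of its subobjects factor through each
  other via the zero morphism, and every small index serves.\<close>

lemma compact_object_zero:
  assumes "zero_object C z"
  shows "compact_object C J (monomorphisms C) z"
proof (rule compact_objectI[OF _ J])
  show "z \<in> Obj C" using assms by (simp add: zero_object_def)
  fix T :: "('i, 'j) diagram_type" and Fo Fm
  assume "T \<in> J"
  then interpret T: diagram_type T by (rule J)
  have "factors_through C g f" if "(f, u, g) \<in> Mor (slice C z)" for f u g
  proof -
    have f: "f \<in> Hom C (Dom C f) z" and g: "g \<in> Hom C (Dom C g) z"
      using that by (auto simp: slice_simps)
    have 0: "HomZero C (Dom C g) (Dom C f) \<in> Hom C (Dom C g) (Dom C f)"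
      using HomZero_in_Hom Hom_Obj(1)[OF f] Hom_Obj(1)[OF g] by blast
    have "\<exists>!k. k \<in> Hom C (Dom C g) z" using assms Hom_Obj[OF g] by (simp add: zero_object_def)
    then have "f \<cdot> HomZero C (Dom C g) (Dom C f) = g"
      using Comp_in_Hom[OF 0 f] g by blast
    then show ?thesis using 0 by (auto simp: factors_through_def)
  qed
  then show "\<exists>i\<^sub>0 \<in> Small T. \<forall>i j. \<forall>h \<in> Hom (Shape T) i\<^sub>0 i. \<forall>k \<in> Hom (Shape T) i j. \<forall>f u g.
      Fm k = (f, u, g) \<longrightarrow> (f, u, g) \<in> Mor (slice C z) \<longrightarrow> monic C f \<longrightarrow> monic C g \<longrightarrow>
      factors_through C g f"
    using T.Small_nonempty by blast
qed

lemma compact_object_quotient: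
  assumes e: "e \<in> Hom C d b" "epic C e" and d: "compact_object C J (monomorphisms C) d"
  shows "compact_object C J (monomorphisms C) b"
proof (rule compact_objectI[OF _ J])
  show bO: "b \<in> Obj C" using Hom_Obj[OF e(1)] by simp
  have b: "Ident C b \<in> Hom C b b" by (rule Ident_in_Hom[OF bO])
  fix T :: "('i, 'j) diagram_type" and Fo Fm
  assume T: "T \<in> J" and F: "covering C J (monomorphisms C) b T Fo Fm"
  obtain i\<^sub>0 where i\<^sub>0: "i\<^sub>0 \<in> Small T"
    and le: "\<And>i j h k f u g. h \<in> Hom (Shape T) i\<^sub>0 i \<Longrightarrow>
      k \<in> Hom (Shape T) i j \<Longrightarrow> Fm k = (f, u, g) \<Longrightarrow>
      factors_through C (image_preimage C (Ident C b) e g) (image_preimage C (Ident C b) e f)"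
    by (rule compact_object_image_preimage[OF d F J[OF T] b e(1)]) blast
  have "factors_through C g f"
    if "h \<in> Hom (Shape T) i\<^sub>0 i" "k \<in> Hom (Shape T) i j" "Fm k = (f, u, g)"
      "(f, u, g) \<in> Mor (slice C b)" "monic C f" for i j h k f u g
    using that(4) by (intro factors_through_of_preimage[OF e _ that(5) _ le[OF that(1,2,3)]])
      (auto simp: slice_simps)
  then show "\<exists>i\<^sub>0 \<in> Small T. \<forall>i j. \<forall>h \<in> Hom (Shape T) i\<^sub>0 i. \<forall>k \<in> Hom (Shape T) i j. \<forall>f u g.
      Fm k = (f, u, g) \<longrightarrow> (f, u, g) \<in> Mor (slice C b) \<longrightarrow> monic C f \<longrightarrow> monic C g \<longrightarrow>
      factors_through C g f"
    using i\<^sub>0 by blast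
qed

text \<open>The covering is transported twice: to \<open>a\<close> by preimages under
  \<open>i\<close>, and to \<open>b\<close> by images under \<open>p\<close>. An arbitrary
  \<open>p\<close> is allowed, so that monomorphisms are covered as well as projections.\<close>

lemma compact_object_extension:
  assumes p: "p \<in> Hom C c b" and i: "is_kernel C i p" "i \<in> Hom C a c"
    and ca: "compact_object C J (monomorphisms C) a" and cb: "compact_object C J (monomorphisms C) b"
  shows "compact_object C J (monomorphisms C) c"
proof (rule compact_objectI[OF _ J])
  show cO: "c \<in> Obj C" using Hom_Obj[OF p] by simp
  have c: "Ident C c \<in> Hom C c c" and b: "Ident C b \<in> Hom C b b"
    using Hom_Obj[OF p] by (simp_all add: Ident_in_Hom)
  fix T :: "('i, 'j) diagram_type" and Fo Fm
  assume TJ: "T \<in> J" and F: "covering C J (monomorphisms C) c T Fo Fm"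
  interpret T: diagram_type T by (rule J[OF TJ])
  obtain i\<^sub>1 where i\<^sub>1: "i\<^sub>1 \<in> Small T"
    and le\<^sub>1: "\<And>l j h k f u g. h \<in> Hom (Shape T) i\<^sub>1 l \<Longrightarrow>
      k \<in> Hom (Shape T) l j \<Longrightarrow> Fm k = (f, u, g) \<Longrightarrow>
      factors_through C (image_preimage C (Ident C c) i g) (image_preimage C (Ident C c) i f)"
    by (rule compact_object_image_preimage[OF ca F J[OF TJ] c i(2)]) blast
  obtain i\<^sub>2 where i\<^sub>2: "i\<^sub>2 \<in> Small T"
    and le\<^sub>2: "\<And>l j h k f u g. h \<in> Hom (Shape T) i\<^sub>2 l \<Longrightarrow>
      k \<in> Hom (Shape T) l j \<Longrightarrow> Fm k = (f, u, g) \<Longrightarrow>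
      factors_through C (image_preimage C p (Ident C b) g) (image_preimage C p (Ident C b) f)"
    by (rule compact_object_image_preimage[OF cb F J[OF TJ] p b]) blast
  \<comment> \<open>A path starting at \<open>i\<^sub>0\<close> extends backwards along
    \<open>h\<^sub>1\<close> and \<open>h\<^sub>2\<close>, so both stability statements apply to
    it.\<close>
  obtain i\<^sub>0 h\<^sub>1 h\<^sub>2 where i\<^sub>0: "i\<^sub>0 \<in> Small T"
    and h\<^sub>1: "h\<^sub>1 \<in> Hom (Shape T) i\<^sub>1 i\<^sub>0"
      and h\<^sub>2: "h\<^sub>2 \<in> Hom (Shape T) i\<^sub>2 i\<^sub>0"
    using T.Small_directed[OF i\<^sub>1 i\<^sub>2] by blast
  have "factors_through C g f"
    if h: "h \<in> Hom (Shape T) i\<^sub>0 l" and k: "k \<in> Hom (Shape T) l j" "Fm k = (f, u, g)"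
      and fug: "(f, u, g) \<in> Mor (slice C c)" "monic C f" "monic C g" for l j h k f u g
  proof (rule factors_through_of_kernel_and_image[OF p i _ fug(2) _ fug(3)])
    show "f \<in> Hom C (Dom C f) c" "g \<in> Hom C (Dom C g) c" "factors_through C f g"
      using fug(1) by (auto simp: slice_simps factors_through_def)
  qed (rule le\<^sub>1[OF T.Comp_in_Hom[OF h\<^sub>1 h] k] le\<^sub>2[OF T.Comp_in_Hom[OF h\<^sub>2 h] k])+
  then show "\<exists>i\<^sub>0 \<in> Small T. \<forall>i j. \<forall>h \<in> Hom (Shape T) i\<^sub>0 i. \<forall>k \<in> Hom (Shape T) i j. \<forall>f u g.
      Fm k = (f, u, g) \<longrightarrow> (f, u, g) \<in> Mor (slice C c) \<longrightarrow> monic C f \<longrightarrow> monic C g \<longrightarrow>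
      factors_through C g f"
    using i\<^sub>0 by blast
qed

text \<open>The kernel of \<open>m\<close> is the morphism from a zero object, which is compact; the
  extension lemma applies with \<open>p = m\<close>.\<close>

lemma compact_object_subobject:
  assumes m: "m \<in> Hom C a c" "monic C m" and c: "compact_object C J (monomorphisms C) c"
  shows "compact_object C J (monomorphisms C) a"
proof -
  obtain z where z: "zero_object C z" using ex_zero_object by blast
  have objs: "a \<in> Obj C" "c \<in> Obj C" "z \<in> Obj C"
    using Hom_Obj[OF m(1)] z by (auto simp: zero_object_def)
  have 0: "HomZero C z a \<in> Hom C z a" by (rule HomZero_in_Hom[OF objs(3,1)])
  have "is_kernel C (HomZero C z a) m"
  proof (rule kernelI[OF m(1) 0])
    show "m \<cdot> HomZero C z a = HomZero C z c" by (rule Comp_zero_right[OF m(1) objs(3)])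
    show "monic C (HomZero C z a)"
    proof (rule monicI[OF 0])
      fix x g assume g: "g \<in> Hom C x z"
      then have x: "x \<in> Obj C" by (rule Hom_Obj)
      then have "\<exists>!k. k \<in> Hom C x z" using z by (simp add: zero_object_def)
      then show "g = HomZero C x z" using g HomZero_in_Hom[OF x objs(3)] by blast
    qed
    fix x h assume h: "h \<in> Hom C x a" and mh: "m \<cdot> h = HomZero C x c"
    have x: "x \<in> Obj C" by (rule Hom_Obj[OF h])
    have "h = HomZero C x a"
      by (rule monic_cancel[OF m(2,1) h HomZero_in_Hom[OF x objs(1)]])
        (simp add: mh Comp_zero_right[OF m(1) x])
    then show "\<exists>u \<in> Hom C x z. HomZero C z a \<cdot> u = h"
      using Comp_zero_right[OF 0 x] HomZero_in_Hom[OF x objs(3)] by blast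
  qed
  then show ?thesis by (rule compact_object_extension[OF m(1) _ 0 compact_object_zero[OF z] c])
qed

text \<open>The mixed relation \<open>p\<^sub>2 \<cdot> i\<^sub>1 = 0\<close> is derived first:
  composing the sum with \<open>i\<^sub>1\<close> gives
  \<open>i\<^sub>2 \<cdot> p\<^sub>2 \<cdot> i\<^sub>1 = 0\<close>, and \<open>p\<^sub>2\<close>
  removes \<open>i\<^sub>2\<close>. Then \<open>i\<^sub>1\<close> is a kernel of
  \<open>p\<^sub>2\<close>, and \<open>b\<close> is an extension of \<open>y\<close> by
  \<open>x\<close>.\<close>

lemma compact_object_biproduct:
  assumes "is_biproduct C x y b i\<^sub>1 i\<^sub>2 p\<^sub>1 p\<^sub>2"
    and x: "compact_object C J (monomorphisms C) x" and y: "compact_object C J (monomorphisms C) y"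
  shows "compact_object C J (monomorphisms C) b"
proof -
  have i1: "i\<^sub>1 \<in> Hom C x b" and i2: "i\<^sub>2 \<in> Hom C y b"
    and p1: "p\<^sub>1 \<in> Hom C b x" and p2: "p\<^sub>2 \<in> Hom C b y"
    and pi: "p\<^sub>1 \<cdot> i\<^sub>1 = Ident C x" "p\<^sub>2 \<cdot> i\<^sub>2 = Ident C y"
      and sum: "(i\<^sub>1 \<cdot> p\<^sub>1) \<oplus> (i\<^sub>2 \<cdot> p\<^sub>2) = Ident C b"
    using assms(1) by (auto simp: is_biproduct_def)
  note ip1 = Comp_in_Hom[OF p1 i1] and ip2 = Comp_in_Hom[OF p2 i2] and pi21 = Comp_in_Hom[OF i1 p2]
  have "i\<^sub>1 = i\<^sub>1 \<oplus> (i\<^sub>2 \<cdot> (p\<^sub>2 \<cdot> i\<^sub>1))"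
    using Comp_add_left[OF ip1 ip2 i1] Comp_assoc[OF i1 p1 i1] Comp_assoc[OF i1 p2 i2]
      pi(1) sum Comp_Ident[OF i1] by simp
  then have "i\<^sub>2 \<cdot> (p\<^sub>2 \<cdot> i\<^sub>1) = HomZero C x b"
    using HomAdd_self_zero[OF i1 _ Comp_in_Hom[OF pi21 i2]] by simp
  then have "(p\<^sub>2 \<cdot> i\<^sub>2) \<cdot> (p\<^sub>2 \<cdot> i\<^sub>1) = HomZero C x y"
    using Comp_assoc[OF pi21 i2 p2] Comp_zero_right[OF p2] Hom_Obj[OF i1] by simp
  then have pi0: "p\<^sub>2 \<cdot> i\<^sub>1 = HomZero C x y" using pi(2) Comp_Ident[OF pi21] by simp
  have split: "i\<^sub>1 \<cdot> (p\<^sub>1 \<cdot> h) = h" if h: "h \<in> Hom C z b"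
    and ph: "p\<^sub>2 \<cdot> h = HomZero C z y" for z h
  proof -
    have "h = (i\<^sub>1 \<cdot> (p\<^sub>1 \<cdot> h)) \<oplus> (i\<^sub>2 \<cdot> (p\<^sub>2 \<cdot> h))"
      using Comp_add_left[OF ip1 ip2 h] Comp_assoc[OF h p1 i1] Comp_assoc[OF h p2 i2]
        sum Comp_Ident[OF h] by simp
    then show ?thesis
      using ph Comp_zero_right[OF i2] Hom_Obj[OF h] HomAdd_zero[OF Comp_in_Hom[OF Comp_in_Hom[OF h p1] i1]]
      by simp
  qed
  have "is_kernel C i\<^sub>1 p\<^sub>2"
  proof (rule kernelI[OF p2 i1 pi0])
    have "monic C (Ident C x)"
      using Ident_in_Hom[OF Hom_Obj(1)[OF i1]] Comp_Ident by (intro monicI) auto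
    then show "monic C i\<^sub>1"
      using monic_right_factor[OF _ i1 p1] pi(1) by simp
    show "\<exists>u \<in> Hom C z x. i\<^sub>1 \<cdot> u = h"
      if "h \<in> Hom C z b" "p\<^sub>2 \<cdot> h = HomZero C z y" for z h
      using split[OF that] Comp_in_Hom[OF that(1) p1] by blast
  qed
  then show ?thesis by (rule compact_object_extension[OF p2 _ i1 x y])
qed

lemma exact_full_abelian_subcategory_compact_objects:
  "exact_full_abelian_subcategory C {c. compact_object C J (monomorphisms C) c}"
proof -
  interpret abelian_closed_class C "{c. compact_object C J (monomorphisms C) c}"
  proof unfold_locales
    show "{c. compact_object C J (monomorphisms C) c} \<subseteq> Obj C"
      by (auto simp: compact_object_def)
    show "Dom C m \<in> {c. compact_object C J (monomorphisms C) c}"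
      if "monic C m" "Cod C m \<in> {c. compact_object C J (monomorphisms C) c}" for m
      using that compact_object_subobject[of m "Dom C m" "Cod C m"] by (simp add: monic_def Hom_def)
    show "Cod C e \<in> {c. compact_object C J (monomorphisms C) c}"
      if "epic C e" "Dom C e \<in> {c. compact_object C J (monomorphisms C) c}" for e
      using that compact_object_quotient[of e "Dom C e" "Cod C e"] by (simp add: epic_def Hom_def)
  qed (auto intro: compact_object_zero compact_object_biproduct)
  show ?thesis by (rule exact_full_subcategory)
qed

end

end

section \<open>Ascending and descending sequences\<close>

lemma nat_poset_simps:
  "Obj nat_poset = UNIV" "k \<in> Mor nat_poset \<longleftrightarrow> fst k \<le> snd k"
  "Dom nat_poset = fst" "Cod nat_poset = snd" "Ident nat_poset n = (n, n)"
  "g \<cdot>\<^bsub>nat_poset\<^esub> f = (fst f, snd g)"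
  by (auto simp: nat_poset_def)

lemma category_nat_poset: "category nat_poset"
  by unfold_locales (auto simp: Hom_def nat_poset_simps)

text \<open>One factor has to be an identity, so the other is the given morphism. Which endpoint
  carries the identity depends on the order of the two factors.\<close>

lemma variance_nat_poset:
  shows "variance nat_poset (Mor nat_poset) (range (Ident nat_poset))"
    and "variance nat_poset (range (Ident nat_poset)) (Mor nat_poset)"
proof -
  interpret category nat_poset by (rule category_nat_poset)
  have wide: "wide_subclass nat_poset (Mor nat_poset)" "wide_subclass nat_poset (range (Ident nat_poset))"
    by (auto simp: wide_subclass_def nat_poset_simps)
  note factorization = cov_contr_factorization_def contr_cov_factorization_def nat_poset_simps
  show "variance nat_poset (Mor nat_poset) (range (Ident nat_poset))"
  proof unfold_locales
    fix k assume "k \<in> Mor nat_poset"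
    then show "\<exists>!p. cov_contr_factorization nat_poset (Mor nat_poset) (range (Ident nat_poset)) k p"
      "\<exists>!p. contr_cov_factorization nat_poset (Mor nat_poset) (range (Ident nat_poset)) k p"
      by (intro ex1I[of _ "(k, Ident nat_poset (snd k))"] ex1I[of _ "(k, Ident nat_poset (fst k))"];
          auto simp: factorization)+
  qed (rule wide)+
  show "variance nat_poset (range (Ident nat_poset)) (Mor nat_poset)"
  proof unfold_locales
    fix k assume "k \<in> Mor nat_poset"
    then show "\<exists>!p. cov_contr_factorization nat_poset (range (Ident nat_poset)) (Mor nat_poset) k p"
      "\<exists>!p. contr_cov_factorization nat_poset (range (Ident nat_poset)) (Mor nat_poset) k p"
      by (intro ex1I[of _ "(Ident nat_poset (fst k), k)"] ex1I[of _ "(Ident nat_poset (snd k), k)"];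
          auto simp: factorization)+
  qed (rule wide)+
qed

lemma nat_poset_directed: "\<exists>z f g. f \<in> Hom nat_poset x z \<and> g \<in> Hom nat_poset y z"
  by (intro exI[of _ "max x y"] exI[of _ "(x, max x y)"] exI[of _ "(y, max x y)"])
    (simp add: Hom_def nat_poset_simps)

lemma diagram_type_ascending: "diagram_type ascending_type"
  using variance_nat_poset(1) nat_poset_directed
  by (simp add: diagram_type_def diagram_type_axioms_def ascending_type_def nat_poset_simps)

lemma diagram_type_descending: "diagram_type descending_type"
  using variance_nat_poset(2) nat_poset_directed
  by (simp add: diagram_type_def diagram_type_axioms_def descending_type_def nat_poset_simps)

theorem corollary2p21:
  fixes C :: "('o, 'm) preadditive_category"
    and J :: "('i, 'j) diagram_type set"
  assumes "abelian_category C"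
    and "\<forall>T \<in> J. diagram_type T"
  shows "exact_full_abelian_subcategory C {c. compact_object C J (monomorphisms C) c} \<and>
    abelian_category (full_subcategory C {c. artinian_object C c}) \<and>
    abelian_category (full_subcategory C {c. noetherian_object C c})"
proof -
  interpret abelian_category C by (rule assms(1))
  have "exact_full_abelian_subcategory C {c. compact_object C J (monomorphisms C) c}"
    using assms(2) by (intro exact_full_abelian_subcategory_compact_objects) blast
  \<comment> \<open>The index types of \<open>J\<close> are arbitrary here, so the two sequence
    types over \<open>nat\<close> call for separate instances of the closure result.\<close>
  moreover have "exact_full_abelian_subcategory C {c. artinian_object C c}"
    unfolding artinian_object_def
    by (rule exact_full_abelian_subcategory_compact_objects) (simp add: diagram_type_descending)
  moreover have "exact_full_abelian_subcategory C {c. noetherian_object C c}"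
    unfolding noetherian_object_def
    by (rule exact_full_abelian_subcategory_compact_objects) (simp add: diagram_type_ascending)
  ultimately show ?thesis by (simp add: exact_full_abelian_subcategory_def)
qed

end
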